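(* Let $X_1,\dots,X_n\subset\mathbb{R}^d$ be compact, $X=X_1\times\dots\times X_n$, and let $\mu_i\in\mathcal{P}(X_i)$ satisfy $\mu_1\preceq_c\dots\preceq_c\mu_n$. Let $c,p\in C(X)$ and, for $\varepsilon\in\mathbb{R}$, define $$P(\varepsilon)=\inf_{\pi\in\Pi_M(\mu_1,\dots,\mu_n)}\int(c+\varepsilon p)\,d\pi .$$ Let $\Pi^M_0(\mu_1,\dots,\mu_n)=\operatorname*{arg\,min}_{\pi\in\Pi_M(\mu_1,\dots,\mu_n)}\int c\,d\pi$. Then $P$ is right-differentiable and left-differentiable at $0$, with right and left derivatives $$P'_+(0)=\inf_{\pi\in\Pi^M_0(\mu_1,\dots,\mu_n)}\int p\,d\pi,\qquad P'_-(0)=\sup_{\pi\in\Pi^M_0(\mu_1,\dots,\mu_n)}\int p\,d\pi .$$ In particular, if there exists a unique optimal $\pi_0\in\Pi^M_0(\mu_1,\dots,\mu_n)$ for $c$, then $P$ is differentiable at $0$ and $P'(0)=\int p\,d\pi_0$.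
   Context: $\mathcal{P}(X)$ is the set of Borel probability measures on $X$. Convex order: $\mu\preceq_c\nu$ means $\int\varphi\,d\mu\le\int\varphi\,d\nu$ for all convex $\varphi:\mathbb{R}^d\to\mathbb{R}$. $\Pi(\mu_1,\dots,\mu_n)$ is the set of probability measures on $X_1\times\dots\times X_n$ with $i$-th marginal $\mu_i$; $\mathrm{Proj}_I(\pi)$ is the marginal of $\pi$ on the coordinates indexed by $I$. Martingale couplings: $\Pi_M(\mu_1,\dots,\mu_n)$ is the set of $\pi\in\Pi(\mu_1,\dots,\mu_n)$ such that for each $i=1,\dots,n-1$, disintegrating $\pi=\mathrm{Proj}_{1\dots i}(\pi)\otimes\kappa_{1\dots i}^{i+1,\dots,n}$ (with $\kappa_{1\dots i}^{i+1,\dots,n}$ the conditional probability of $x_{i+1},\dots,x_n$ given $x_1,\dots,x_i$), one has $\int x_{i+1}\,\kappa_{1\dots i}^{i+1,\dots,n}(x_1,\dots,x_i,dx_{i+1},\dots,dx_n)=x_i$ for $\mathrm{Proj}_{1\dots i}(\pi)$-almost every $(x_1,\dots,x_i)$. *)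

theory Defs
  imports "HOL-Probability.Probability"
begin

definition borel_probs :: "'a::topological_space set \<Rightarrow> 'a measure set" where
  "borel_probs X = {\<mu>. prob_space \<mu> \<and> sets \<mu> = sets (restrict_space borel X)}"

(* Meant for measures with compact support: a convex function on the whole space is continuous,
   hence integrable against them, and the default value of the Bochner integral never enters. *)
definition convex_order :: "'a::euclidean_space measure \<Rightarrow> 'a measure \<Rightarrow> bool" where
  "convex_order \<mu> \<nu> \<longleftrightarrow>
     (\<forall>\<phi>::'a \<Rightarrow> real. convex_on UNIV \<phi> \<longrightarrow> (\<integral>x. \<phi> x \<partial>\<mu>) \<le> (\<integral>x. \<phi> x \<partial>\<nu>))"

(* A point of the product of the X i (i in I) is an element of PiE I X. The product
   sigma-algebra is the Borel sigma-algebra of the product topology (sets_prod_space_eq_borel). *)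
definition prod_space :: "nat set \<Rightarrow> (nat \<Rightarrow> 'a::euclidean_space set) \<Rightarrow> (nat \<Rightarrow> 'a) measure" where
  "prod_space I X = (\<Pi>\<^sub>M i\<in>I. restrict_space borel (X i))"

lemma space_prod_space: "space (prod_space I X) = (\<Pi>\<^sub>E i\<in>I. X i)"
  by (simp add: prod_space_def space_PiM space_restrict_space)

lemma sets_le_of_id:
  assumes "(\<lambda>x. x) \<in> measurable M N" and "space M = space N"
  shows "sets N \<subseteq> sets M"
proof
  fix A assume A: "A \<in> sets N"
  with assms(2) have "A \<subseteq> space M" using sets.sets_into_space by auto
  then have "(\<lambda>x. x) -` A \<inter> space M = A" by auto
  then show "A \<in> sets M" using measurable_sets[OF assms(1) A] by simp
qed

lemma sets_prod_space_eq_borel: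
  "sets (prod_space I X) = sets (restrict_space borel (\<Pi>\<^sub>E i\<in>I. X i))"
proof
  let ?B = "restrict_space borel (\<Pi>\<^sub>E i\<in>I. X i)"
  have "(\<lambda>x. x) \<in> measurable ?B (prod_space I X)"
    unfolding prod_space_def
  proof (rule measurable_PiM_single')
    fix i assume i: "i \<in> I"
    have "(\<lambda>x::nat \<Rightarrow> 'a. x i) \<in> borel_measurable borel"
      by (intro borel_measurable_continuous_onI continuous_on_product_coordinates)
    then show "(\<lambda>x. x i) \<in> measurable ?B (restrict_space borel (X i))"
      using i by (intro measurable_restrict_space2 measurable_restrict_space1)
        (auto simp: space_restrict_space PiE_mem)
  qed (simp add: space_restrict_space)
  then show "sets (prod_space I X) \<subseteq> sets ?B"
    by (rule sets_le_of_id) (simp add: space_prod_space space_restrict_space)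
next
  let ?B = "restrict_space borel (\<Pi>\<^sub>E i\<in>I. X i)"
  have "(\<lambda>x. x) \<in> measurable (prod_space I X) (\<Pi>\<^sub>M i\<in>UNIV. (borel :: 'a measure))"
  proof (rule measurable_PiM_single')
    fix i :: nat
    show "(\<lambda>x. x i) \<in> measurable (prod_space I X) (borel :: 'a measure)"
    proof (cases "i \<in> I")
      case True
      then have "(\<lambda>x. x i) \<in> measurable (prod_space I X) (restrict_space borel (X i))"
        unfolding prod_space_def by (rule measurable_component_singleton)
      then show ?thesis by (rule measurable_restrict_space2_iff[THEN iffD1, THEN conjunct1])
    next
      case False
      have "x i = undefined" if "x \<in> space (prod_space I X)" for x
        using that \<open>i \<notin> I\<close> unfolding space_prod_space by (rule PiE_arb)
      then have "(\<lambda>x. x i) \<in> measurable (prod_space I X) (borel :: 'a measure)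
          \<longleftrightarrow> (\<lambda>x. undefined) \<in> measurable (prod_space I X) (borel :: 'a measure)"
        by (rule measurable_cong)
      then show ?thesis by simp
    qed
  qed simp
  then have "(\<lambda>x. x) \<in> measurable (prod_space I X) (borel :: (nat \<Rightarrow> 'a) measure)"
    by (subst (asm) measurable_cong_sets[OF refl sets_PiM_equal_borel])
  then have "(\<lambda>x. x) \<in> measurable (prod_space I X) ?B"
    by (intro measurable_restrict_space2) (auto simp: space_prod_space)
  then show "sets ?B \<subseteq> sets (prod_space I X)"
    by (rule sets_le_of_id) (simp add: space_prod_space space_restrict_space)
qed

definition marginal :: "nat set \<Rightarrow> (nat \<Rightarrow> 'a::euclidean_space set) \<Rightarrow> (nat \<Rightarrow> 'a) measure \<Rightarrow> (nat \<Rightarrow> 'a) measure"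
  where "marginal I X \<pi> = distr \<pi> (prod_space I X) (\<lambda>x. restrict x I)"

definition couplings ::
  "nat \<Rightarrow> (nat \<Rightarrow> 'a::euclidean_space set) \<Rightarrow> (nat \<Rightarrow> 'a measure) \<Rightarrow> (nat \<Rightarrow> 'a) measure set" where
  "couplings n X \<mu> =
     {\<pi> \<in> borel_probs (\<Pi>\<^sub>E i\<in>{1..n}. X i).
        (\<forall>i\<in>{1..n}. distr \<pi> (restrict_space borel (X i)) (\<lambda>x. x i) = \<mu> i)}"

(* \<kappa> is a version of the conditional law of (x (i+1), ..., x n) given (x 1, ..., x i):
   a probability kernel with \<pi> equal to the semidirect product of marginal {1..i} X \<pi> and \<kappa>;
   merge glues the two blocks of coordinates. *)
definition is_disintegration ::
  "nat \<Rightarrow> nat \<Rightarrow> (nat \<Rightarrow> 'a::euclidean_space set) \<Rightarrow> (nat \<Rightarrow> 'a) measure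
     \<Rightarrow> ((nat \<Rightarrow> 'a) \<Rightarrow> (nat \<Rightarrow> 'a) measure) \<Rightarrow> bool" where
  "is_disintegration n i X \<pi> \<kappa> \<longleftrightarrow>
     \<kappa> \<in> measurable (prod_space {1..i} X) (prob_algebra (prod_space {i+1..n} X)) \<and>
     \<pi> = marginal {1..i} X \<pi> \<bind>
           (\<lambda>x. distr (\<kappa> x) (prod_space {1..n} X) (\<lambda>y. merge {1..i} {i+1..n} (x, y)))"

(* The kernel is unique up to a null set of the marginal, so the existential quantifier
   does not depend on the version chosen. *)
definition martingale_couplings ::
  "nat \<Rightarrow> (nat \<Rightarrow> 'a::euclidean_space set) \<Rightarrow> (nat \<Rightarrow> 'a measure) \<Rightarrow> (nat \<Rightarrow> 'a) measure set" where
  "martingale_couplings n X \<mu> =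
     {\<pi> \<in> couplings n X \<mu>. \<forall>i\<in>{1..<n}. \<exists>\<kappa>. is_disintegration n i X \<pi> \<kappa> \<and>
        (AE x in marginal {1..i} X \<pi>. (\<integral>y. y (i+1) \<partial>\<kappa> x) = x i)}"

definition mot_value ::
  "nat \<Rightarrow> (nat \<Rightarrow> 'a::euclidean_space set) \<Rightarrow> (nat \<Rightarrow> 'a measure) \<Rightarrow> ((nat \<Rightarrow> 'a) \<Rightarrow> real) \<Rightarrow> real" where
  "mot_value n X \<mu> c = (INF \<pi>\<in>martingale_couplings n X \<mu>. \<integral>x. c x \<partial>\<pi>)"

definition mot_optimizers ::
  "nat \<Rightarrow> (nat \<Rightarrow> 'a::euclidean_space set) \<Rightarrow> (nat \<Rightarrow> 'a measure) \<Rightarrow> ((nat \<Rightarrow> 'a) \<Rightarrow> real)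
     \<Rightarrow> (nat \<Rightarrow> 'a) measure set" where
  "mot_optimizers n X \<mu> c =
     {\<pi>. is_arg_min (\<lambda>\<pi>. \<integral>x. c x \<partial>\<pi>) (\<lambda>\<pi>. \<pi> \<in> martingale_couplings n X \<mu>) \<pi>}"

end

theory Submission
  imports Defs
begin

text \<open>Three facts about the set of martingale couplings give the theorem: it is cut out of the
  probability measures on the compact product space by countably many linear equations
  \<open>\<integral>G d\<pi> = 0\<close> with \<open>G\<close> continuous, it is nonempty, and it is sequentially compact for weak convergence.
  The pairs \<open>(\<integral>c d\<pi>, \<integral>p d\<pi>)\<close> then fill a nonempty compact set in the plane, and \<open>P(\<epsilon>)\<close> minimises
  \<open>u + \<epsilon> v\<close> over that set: for small \<open>\<epsilon>\<close> only points with nearly minimal \<open>u\<close> compete.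

  Nonemptiness is Strassen's theorem. Minimising \<open>\<Sum>(\<integral>G\<^sub>j d\<gamma>)\<^sup>2\<close> over all probability measures, the first
  order condition in the direction of a Dirac mass bounds a linear combination of the \<open>G\<^sub>j\<close> from below by
  the minimal value; but the convex order does not allow a strictly positive lower bound.
  Weak compactness is reduced to Helly's selection theorem on the line by coding the compact space
  as a Borel subset of the reals. The same coding yields the disintegrations.\<close>

section \<open>Weak compactness of probability measures on a compact set\<close>

text \<open>The martingale condition is stated through conditional kernels, and kernels do not
  depend continuously on the measure, so its stability under weak limits is not visible. Testing an
  increment against continuous functions of the past removes the kernel: the condition becomes a
  family of integrals against the coupling itself. Countably many tests suffice because the Borel
  sets have a countable intersection-stable generator, and countability lets existence follow from
  finite subsystems and one weak limit. Least squares stands in for a separation theorem: at a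
  minimiser the residual vector is itself the vector of coefficients of the forbidden positive lower
  bound, so nothing has to be separated in a space of functions. The lower bound is refuted by
  backward induction over time, where boundedness of the functions that multiply the increments
  keeps the arising convex functions finite on the whole space.\<close>

text \<open>Points are coded by the ternary digits recording membership in the sets of a countable basis.
  The code is only Borel, but its inverse is uniformly continuous and so extends to the closure.\<close>

lemma ternary_digits_eq:
  fixes d d' :: "nat \<Rightarrow> real"
  assumes d: "\<And>k. d k \<in> {0, 1}" "\<And>k. d' k \<in> {0, 1}"
    and close: "\<bar>(\<Sum>k. d k * (1/3)^k) - (\<Sum>k. d' k * (1/3)^k)\<bar> < (1/3)^m / 2"
    and "k \<le> m"
  shows "d k = d' k"
proof (rule ccontr)
  assume "d k \<noteq> d' k"
  define l where "l = (LEAST j. d j \<noteq> d' j)"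
  have l: "d l \<noteq> d' l" unfolding l_def by (rule LeastI) fact
  have below: "d j = d' j" if "j < l" for j
    using not_less_Least that unfolding l_def by blast
  have "l \<le> m" using Least_le[of "\<lambda>j. d j \<noteq> d' j" k] \<open>d k \<noteq> d' k\<close> \<open>k \<le> m\<close> l_def by simp
  define \<delta> where "\<delta> j = (d j - d' j) * (1/3)^j" for j
  have geo: "summable (\<lambda>j. (1/3::real)^j)" by (rule summable_geometric) simp
  have bnd: "\<bar>\<delta> j\<bar> \<le> (1/3)^j" for j
    using d(1)[of j] d(2)[of j] by (auto simp: \<delta>_def)
  have sd: "summable (\<lambda>k. d k * (1/3)^k)"
    by (rule summable_comparison_test'[OF geo, of 0]) (use d(1) in \<open>auto simp: abs_mult intro!: mult_left_le_one_le, metis (no_types) insertE singletonD abs_zero abs_one order_refl zero_le_one\<close>)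
  have sd': "summable (\<lambda>k. d' k * (1/3)^k)"
    by (rule summable_comparison_test'[OF geo, of 0]) (use d(2) in \<open>auto simp: abs_mult intro!: mult_left_le_one_le, metis (no_types) insertE singletonD abs_zero abs_one order_refl zero_le_one\<close>)
  have s\<delta>: "summable \<delta>"
    using summable_diff[OF sd sd'] by (simp add: \<delta>_def[abs_def] left_diff_distrib)
  have eq: "(\<Sum>k. d k * (1/3)^k) - (\<Sum>k. d' k * (1/3)^k) = (\<Sum>j. \<delta> j)"
    using suminf_diff[OF sd sd'] by (simp add: \<delta>_def[abs_def] left_diff_distrib)
  have "(\<Sum>j. \<delta> j) = (\<Sum>j. \<delta> (j + Suc l)) + (\<Sum>j<Suc l. \<delta> j)"
    by (rule suminf_split_initial_segment[OF s\<delta>])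
  also have "(\<Sum>j<Suc l. \<delta> j) = \<delta> l"
    using below by (simp add: \<delta>_def)
  finally have split: "(\<Sum>j. \<delta> j) = (\<Sum>j. \<delta> (j + Suc l)) + \<delta> l" .
  have sl: "summable (\<lambda>j. (1/3::real)^(j + Suc l))" using geo by (subst summable_iff_shift)
  \<comment> \<open>Base 3 matters here: the digits after place \<open>l\<close> can cancel at most
    half of the weight \<open>(1/3)^l\<close>, so a first disagreement at \<open>l\<close> leaves a
    gap of at least \<open>(1/3)^l / 2\<close>. In base 2 the tail could cancel it entirely.\<close>
  have "\<bar>\<Sum>j. \<delta> (j + Suc l)\<bar> \<le> (\<Sum>j. (1/3)^(j + Suc l))"
    using norm_suminf_le[of "\<lambda>j. \<delta> (j + Suc l)", OF _ sl] bnd[of "_ + Suc l"] by simp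
  also have "\<dots> = (1/3)^Suc l * (\<Sum>j. (1/3)^j)"
    by (subst suminf_mult[OF geo, symmetric]) (simp add: power_add mult.commute)
  also have "\<dots> = (1/3)^l / 2" by (subst suminf_geometric) auto
  finally have "\<bar>\<Sum>j. \<delta> (j + Suc l)\<bar> \<le> (1/3)^l / 2" .
  moreover have "\<bar>\<delta> l\<bar> = (1/3)^l"
    using d(1)[of l] d(2)[of l] l by (auto simp: \<delta>_def)
  ultimately have "(1/3)^l / 2 \<le> \<bar>\<Sum>j. \<delta> j\<bar>" unfolding split by linarith
  moreover have "(1/3::real)^m \<le> (1/3)^l" using \<open>l \<le> m\<close> by (intro power_decreasing) auto
  ultimately show False using close eq by linarith
qed

text \<open>Only the decoding \<open>f\<close> has to be continuous: test functions on
  \<open>K\<close> are composed with \<open>f\<close>, while \<open>g\<close> merely moves measures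
  to the line. \<open>C\<close> may exceed the set of codes because a limit of measures carried by
  the codes may charge points that are not codes.\<close>

lemma compact_borel_coding:
  fixes K :: "'b::polish_space set"
  assumes K: "compact K"
  obtains g :: "'b \<Rightarrow> real" and f :: "real \<Rightarrow> 'b" and C :: "real set"
  where "g \<in> borel_measurable borel" "compact C" "continuous_on C f" "f ` C \<subseteq> K"
    "g ` K \<subseteq> C" "\<And>x. x \<in> K \<Longrightarrow> f (g x) = x"
proof -
  obtain B :: "'b set set" where B: "countable B" "topological_basis B"
    using ex_countable_basis by blast
  have "B \<noteq> {}"
  proof
    assume "B = {}"
    with B(2) show False
      using topological_basisE[OF B(2) open_UNIV] by blast
  qed
  define U where "U = from_nat_into B"
  have U: "U k \<in> B" for k unfolding U_def by (rule from_nat_into) fact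
  have U_open: "open (U k)" for k using U B(2) by (rule topological_basis_open[rotated])
  define d where "d x k = indicat_real (U k) x" for x k
  define g where "g x = (\<Sum>k. d x k * (1/3)^k)" for x
  have d: "d x k \<in> {0, 1}" for x k by (auto simp: d_def indicator_def)
  have g_meas: "g \<in> borel_measurable borel"
  proof -
    have [measurable]: "U k \<in> sets borel" for k using U_open by (rule borel_open)
    show ?thesis unfolding g_def[abs_def] d_def by measurable
  qed
  have geo: "summable (\<lambda>j. (1/3::real)^j)" by (rule summable_geometric) simp
  have g_bd: "\<bar>g x\<bar> \<le> 3/2" for x
  proof -
    have "\<bar>g x\<bar> \<le> (\<Sum>j. (1/3)^j)" unfolding g_def
      using norm_suminf_le[of "\<lambda>j. d x j * (1/3)^j", OF _ geo]
      by (simp add: d_def indicator_def abs_mult)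
    also have "\<dots> = 3/2" by (subst suminf_geometric) auto
    finally show ?thesis .
  qed
  \<comment> \<open>Compactness bounds the number of digits that matter: finitely many basis sets
    inside balls of radius \<open>\<epsilon>/2\<close> cover \<open>K\<close>, and codes closer than
    \<open>(1/3)^m / 2\<close> agree on membership in each of them.\<close>
  have key: "\<exists>\<delta>>0. \<forall>x\<in>K. \<forall>y\<in>K. \<bar>g x - g y\<bar> < \<delta> \<longrightarrow> dist x y < \<epsilon>" if "\<epsilon> > 0" for \<epsilon>
  proof -
    have "\<exists>k. x \<in> U k \<and> U k \<subseteq> ball x (\<epsilon>/2)" for x
    proof -
      obtain V where "V \<in> B" "x \<in> V" "V \<subseteq> ball x (\<epsilon>/2)"
        using topological_basisE[OF B(2), of "ball x (\<epsilon>/2)" x] \<open>\<epsilon> > 0\<close> by auto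
      moreover obtain k where "U k = V"
        unfolding U_def using from_nat_into_surj[OF B(1) \<open>V \<in> B\<close>] by blast
      ultimately show ?thesis by blast
    qed
    then obtain k where k: "\<And>x. x \<in> U (k x)" "\<And>x. U (k x) \<subseteq> ball x (\<epsilon>/2)" by metis
    obtain F where F: "F \<subseteq> K" "finite F" "K \<subseteq> (\<Union>x\<in>F. U (k x))"
      using compactE_image[OF K, of K "\<lambda>x. U (k x)"] U_open k(1) by blast
    define m where "m = Max (insert 0 (k ` F))"
    have m: "k x \<le> m" if "x \<in> F" for x unfolding m_def using F(2) that by (intro Max_ge) auto
    show ?thesis
    proof (intro exI conjI ballI impI)
      show "(1/3::real)^m / 2 > 0" by simp
      fix x y assume "x \<in> K" "y \<in> K" and *: "\<bar>g x - g y\<bar> < (1/3)^m / 2"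
      obtain z where z: "z \<in> F" "x \<in> U (k z)" using F(3) \<open>x \<in> K\<close> by blast
      have "d x (k z) = d y (k z)"
        by (rule ternary_digits_eq[OF d d]) (use * m[OF z(1)] g_def in auto)
      then have "y \<in> U (k z)" using z(2) by (auto simp: d_def indicator_def split: if_splits)
      then have "dist z x < \<epsilon>/2" "dist z y < \<epsilon>/2" using z(2) k(2)[of z] by auto
      then show "dist x y < \<epsilon>" using dist_triangle_half_r by blast
    qed
  qed
  have inj: "inj_on g K"
  proof (rule inj_onI, rule ccontr)
    fix x y assume "x \<in> K" "y \<in> K" "g x = g y" "x \<noteq> y"
    then show False using key[of "dist x y"] by force
  qed
  define f0 where "f0 = inv_into K g"
  have f0: "f0 (g x) = x" if "x \<in> K" for x using inj that by (simp add: f0_def)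
  have "uniformly_continuous_on (g ` K) f0"
    unfolding uniformly_continuous_on_def
  proof (intro allI impI)
    fix \<epsilon> :: real assume "\<epsilon> > 0"
    then obtain \<delta> where "\<delta> > 0" "\<forall>x\<in>K. \<forall>y\<in>K. \<bar>g x - g y\<bar> < \<delta> \<longrightarrow> dist x y < \<epsilon>" using key by blast
    then show "\<exists>d>0. \<forall>x\<in>g ` K. \<forall>x'\<in>g ` K. dist x' x < d \<longrightarrow> dist (f0 x') (f0 x) < \<epsilon>"
      by (intro exI[of _ \<delta>]) (auto simp: f0 dist_real_def)
  qed
  then obtain f where f: "uniformly_continuous_on (closure (g ` K)) f"
      "\<And>t. t \<in> g ` K \<Longrightarrow> f0 t = f t"
    by (rule uniformly_continuous_on_extension_on_closure) blast
  have ct: "continuous_on (closure (g ` K)) f" using f(1) by (rule uniformly_continuous_imp_continuous)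
  show thesis
  proof
    show "g \<in> borel_measurable borel" by fact
    have "bounded (g ` K)" using g_bd by (intro boundedI[of _ "3/2"]) auto
    then show "compact (closure (g ` K))" by (simp add: compact_closure)
    show "continuous_on (closure (g ` K)) f" by fact
    show "f ` closure (g ` K) \<subseteq> K"
      by (rule image_closure_subset[OF ct compact_imp_closed[OF K]]) (use f(2) f0 in force)
    show "g ` K \<subseteq> closure (g ` K)" by (rule closure_subset)
    show "f (g x) = x" if "x \<in> K" for x using f(2)[of "g x"] f0 that by simp
  qed
qed

lemma borel_probs_iff:
  "\<gamma> \<in> borel_probs K \<longleftrightarrow> prob_space \<gamma> \<and> sets \<gamma> = sets (restrict_space borel K)"
  by (simp add: borel_probs_def)

lemma space_borel_probs: "\<gamma> \<in> borel_probs K \<Longrightarrow> space \<gamma> = K"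
  using sets_eq_imp_space_eq[of \<gamma> "restrict_space borel K"]
  by (simp add: borel_probs_iff space_restrict_space)

lemma borel_measurable_borel_probs:
  assumes "\<gamma> \<in> borel_probs K" "continuous_on K \<phi>"
  shows "\<phi> \<in> borel_measurable \<gamma>"
proof -
  have "\<phi> \<in> borel_measurable (restrict_space borel K)"
    by (rule borel_measurable_continuous_on_restrict[OF assms(2)])
  then show ?thesis using assms(1) by (simp add: borel_probs_iff cong: measurable_cong_sets)
qed

lemma compact_continuous_bounded:
  fixes \<phi> :: "'b::topological_space \<Rightarrow> 'c::real_normed_vector"
  assumes "compact K" "continuous_on K \<phi>"
  obtains B where "B \<ge> 0" "\<And>x. x \<in> K \<Longrightarrow> norm (\<phi> x) \<le> B"
proof -
  obtain B where "\<forall>x\<in>\<phi> ` K. norm x \<le> B"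
    using compact_imp_bounded[OF compact_continuous_image[OF assms(2,1)]] unfolding bounded_iff by blast
  then show thesis using that[of "\<bar>B\<bar>"] by fastforce
qed

lemma integrable_borel_probs:
  fixes \<phi> :: "'b::topological_space \<Rightarrow> 'c::{banach, second_countable_topology}"
  assumes "\<gamma> \<in> borel_probs K" "compact K" "continuous_on K \<phi>"
  shows "integrable \<gamma> \<phi>"
proof -
  interpret prob_space \<gamma> using assms(1) by (simp add: borel_probs_iff)
  obtain B where "\<And>x. x \<in> K \<Longrightarrow> norm (\<phi> x) \<le> B"
    using compact_continuous_bounded[OF assms(2,3)] by metis
  then show ?thesis
    using borel_measurable_borel_probs[OF assms(1,3)] space_borel_probs[OF assms(1)]
    by (intro integrable_const_bound[where B = B] AE_I2) auto
qed

lemma borel_probs_nonempty: "\<gamma> \<in> borel_probs K \<Longrightarrow> K \<noteq> {}"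
  using space_borel_probs[of \<gamma> K] prob_space.not_empty[of \<gamma>] by (auto simp: borel_probs_iff)

text \<open>Sequential Prokhorov theorem on a compact set. All codes lie in one bounded interval, so
  the image measures are automatically tight; the limit on the line is decoded by \<open>f\<close>,
  through which every test function on \<open>K\<close> becomes continuous on
  \<open>C\<close>.\<close>

theorem borel_probs_seq_compact:
  fixes K :: "'b::polish_space set" and \<gamma> :: "nat \<Rightarrow> 'b measure"
  assumes K: "compact K" and \<gamma>: "\<And>k. \<gamma> k \<in> borel_probs K"
  obtains r \<rho> where "strict_mono r" "\<rho> \<in> borel_probs K"
    "\<And>\<phi> :: 'b \<Rightarrow> real. continuous_on K \<phi> \<Longrightarrow> (\<lambda>k. \<integral>x. \<phi> x \<partial>\<gamma> (r k)) \<longlonglongrightarrow> (\<integral>x. \<phi> x \<partial>\<rho>)"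
proof -
  obtain g :: "'b \<Rightarrow> real" and f :: "real \<Rightarrow> 'b" and C :: "real set"
    where g: "g \<in> borel_measurable borel" and C: "compact C" and f: "continuous_on C f" "f ` C \<subseteq> K"
    and gC: "g ` K \<subseteq> C" and fg: "\<And>x. x \<in> K \<Longrightarrow> f (g x) = x"
    by (rule compact_borel_coding[OF K]) blast
  have [measurable]: "g \<in> borel_measurable (\<gamma> k)" for k
    using measurable_restrict_space1[OF g, of K] \<gamma>[of k]
    by (simp add: borel_probs_iff cong: measurable_cong_sets)
  have sp: "space (\<gamma> k) = K" for k by (rule space_borel_probs[OF \<gamma>])
  obtain k0 where k0: "k0 \<in> K" using borel_probs_nonempty[OF \<gamma>] by blast
  have C_ne: "C \<noteq> {}" using k0 gC by blast
  define \<nu> where "\<nu> k = distr (\<gamma> k) borel g" for k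
  have \<nu>_rd: "real_distribution (\<nu> k)" for k
  proof -
    interpret prob_space "\<gamma> k" using \<gamma>[of k] by (simp add: borel_probs_iff)
    show ?thesis unfolding \<nu>_def by (rule real_distribution_distr) measurable
  qed
  obtain b where b: "\<And>t. t \<in> C \<Longrightarrow> \<bar>t\<bar> < b"
  proof -
    obtain b0 where "\<forall>t\<in>C. norm t \<le> b0" using compact_imp_bounded[OF C] unfolding bounded_iff by blast
    then show thesis by (intro that[of "b0 + 1"]) force
  qed
  have b_pos: "0 < b" using b C_ne by fastforce
  have "tight \<nu>"
    unfolding tight_def
  proof (intro conjI allI impI exI)
    show "real_distribution (\<nu> k)" for k by (rule \<nu>_rd)
    show "- b < b" using b_pos by simp
    fix \<epsilon> :: real and k assume "\<epsilon> > 0"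
    interpret prob_space "\<gamma> k" using \<gamma>[of k] by (simp add: borel_probs_iff)
    have "g -` {-b<..b} \<inter> space (\<gamma> k) = space (\<gamma> k)" using gC b sp by (fastforce simp: image_subset_iff)
    then have "measure (\<nu> k) {-b<..b} = 1" by (simp add: \<nu>_def measure_distr prob_space)
    then show "1 - \<epsilon> < measure (\<nu> k) {-b<..b}" using \<open>\<epsilon> > 0\<close> by simp
  qed
  from tight_imp_convergent_subsubsequence[OF this strict_mono_id]
  obtain r M where r: "strict_mono r" and M: "real_distribution M" and wc: "weak_conv_m (\<nu> \<circ> r) M"
    by auto
  interpret M: real_distribution M by fact
  have conv: "(\<lambda>k. \<integral>x. h (g x) \<partial>\<gamma> (r k)) \<longlonglongrightarrow> (\<integral>t. h t \<partial>M)"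
    if h: "continuous_on UNIV h" "\<And>t. norm (h t) \<le> B" for h :: "real \<Rightarrow> real" and B
  proof -
    have [measurable]: "h \<in> borel_measurable borel" by (rule borel_measurable_continuous_onI[OF h(1)])
    have "(\<lambda>k. integral\<^sup>L ((\<nu> \<circ> r) k) h) \<longlonglongrightarrow> integral\<^sup>L M h"
      by (rule weak_conv_imp_integral_bdd_continuous_conv[OF _ M wc])
        (use h \<nu>_rd in \<open>auto simp: continuous_on_eq_continuous_at\<close>)
    then show ?thesis by (simp add: \<nu>_def integral_distr)
  qed
  \<comment> \<open>The distance to \<open>C\<close>, truncated at 1 to be bounded, integrates to 0
    along the sequence and hence in the limit, which places the limit on the closed set
    \<open>C\<close>.\<close>
  have AEC: "AE t in M. t \<in> C"
  proof -
    define h where "h t = min 1 (infdist t C)" for t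
    have h: "continuous_on UNIV h" unfolding h_def by (intro continuous_intros)
    have h0: "0 \<le> h t" "norm (h t) \<le> 1" for t by (auto simp: h_def infdist_nonneg)
    have [measurable]: "h \<in> borel_measurable borel" by (rule borel_measurable_continuous_onI[OF h])
    have "h (g x) = 0" if "x \<in> K" for x using that gC by (auto simp: h_def image_subset_iff)
    then have "(\<integral>x. h (g x) \<partial>\<gamma> k) = (\<integral>x. 0 \<partial>\<gamma> k)" for k
      by (intro Bochner_Integration.integral_cong) (auto simp: sp)
    then have "(\<integral>t. h t \<partial>M) = 0"
      using conv[OF h h0(2)] by (simp add: LIMSEQ_const_iff)
    moreover have "integrable M h"
      by (intro M.integrable_const_bound[where B = 1]) (use h0 in auto)
    ultimately have "AE t in M. h t = 0"
      using integral_nonneg_eq_0_iff_AE[of M h] h0(1) by simp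
    then show ?thesis
    proof (rule AE_mp, intro AE_I2 impI)
      fix t assume "h t = 0"
      then have "infdist t C = 0" by (auto simp: h_def min_def split: if_splits)
      then show "t \<in> C" using in_closed_iff_infdist_zero[OF compact_imp_closed[OF C] C_ne] by simp
    qed
  qed
  \<comment> \<open>Decoding needs a total map into \<open>K\<close>; the filler \<open>k0\<close>
    is taken only off \<open>C\<close>, a null set of \<open>M\<close>.\<close>
  define f' where "f' t = (if t \<in> C then f t else k0)" for t
  have [measurable]: "C \<in> sets borel" using C by (intro borel_closed compact_imp_closed)
  have f'_meas: "f' \<in> measurable M (restrict_space borel K)"
  proof (rule measurable_restrict_space2)
    show "f' \<in> space M \<rightarrow> K" using f(2) k0 by (force simp: f'_def)
    have "f' \<in> measurable borel borel" unfolding f'_def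
      by (rule measurable_If_restrict_space_iff[THEN iffD2])
        (auto intro: borel_measurable_continuous_on_restrict[OF f(1)])
    then show "f' \<in> measurable M borel" by simp
  qed
  define \<rho> where "\<rho> = distr M (restrict_space borel K) f'"
  have \<rho>: "\<rho> \<in> borel_probs K"
    unfolding \<rho>_def borel_probs_iff using M.prob_space_distr[OF f'_meas] by simp
  have "(\<lambda>k. \<integral>x. \<phi> x \<partial>\<gamma> (r k)) \<longlonglongrightarrow> (\<integral>x. \<phi> x \<partial>\<rho>)" if \<phi>: "continuous_on K \<phi>" for \<phi> :: "'b \<Rightarrow> real"
  proof -
    obtain B where B: "B \<ge> 0" "\<And>x. x \<in> K \<Longrightarrow> norm (\<phi> x) \<le> B"
      using compact_continuous_bounded[OF K \<phi>] by metis
    have cc: "continuous_on C (\<lambda>t. \<phi> (f t))"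
      using continuous_on_compose2[OF \<phi> f(1)] f(2) by auto
    \<comment> \<open>Convergence on the line is tested with functions continuous on all of it,
      whereas \<open>\<phi> (f t)\<close> is continuous only on \<open>C\<close>. The Tietze
      extension keeps the bound \<open>B\<close>.\<close>
    obtain h where h: "continuous_on UNIV h" "\<And>t. t \<in> C \<Longrightarrow> h t = \<phi> (f t)" "\<And>t. norm (h t) \<le> B"
      by (rule Tietze[OF cc, of UNIV B]) (use compact_imp_closed[OF C] B f(2) in auto)
    have [measurable]: "h \<in> borel_measurable borel" by (rule borel_measurable_continuous_onI[OF h(1)])
    have "(\<integral>x. h (g x) \<partial>\<gamma> k) = (\<integral>x. \<phi> x \<partial>\<gamma> k)" for k
      by (intro Bochner_Integration.integral_cong) (use sp gC h(2) fg in auto)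
    moreover have "(\<integral>t. h t \<partial>M) = (\<integral>x. \<phi> x \<partial>\<rho>)"
    proof -
      have m: "\<phi> \<in> borel_measurable (restrict_space borel K)"
        by (rule borel_measurable_continuous_on_restrict[OF \<phi>])
      have "(\<integral>x. \<phi> x \<partial>\<rho>) = (\<integral>t. \<phi> (f' t) \<partial>M)"
        unfolding \<rho>_def by (rule integral_distr[OF f'_meas m])
      also have "\<dots> = (\<integral>t. h t \<partial>M)"
      proof (rule integral_cong_AE)
        show "(\<lambda>t. \<phi> (f' t)) \<in> borel_measurable M" using measurable_compose[OF f'_meas m] .
        show "AE t in M. \<phi> (f' t) = h t" using AEC by eventually_elim (simp add: f'_def h(2))
      qed simp
      finally show ?thesis by simp
    qed
    ultimately show ?thesis using conv[OF h(1,3)] by simp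
  qed
  then show thesis using that r \<rho> by blast
qed

section \<open>Probability measures with prescribed moments\<close>

text \<open>The convex combination is realised as a Bernoulli mixture of a point mass and
  \<open>\<gamma>\<close>, which makes the integral formula an instance of integration against a
  bind.\<close>

lemma borel_probs_mixture:
  assumes \<gamma>: "\<gamma> \<in> borel_probs K" and K: "compact K" and z: "z \<in> K" and t: "0 \<le> t" "t \<le> (1::real)"
  obtains \<gamma>' where "\<gamma>' \<in> borel_probs K"
    "\<And>\<phi> :: 'b::t2_space \<Rightarrow> real. continuous_on K \<phi> \<Longrightarrow>
        (\<integral>x. \<phi> x \<partial>\<gamma>') = t * \<phi> z + (1 - t) * (\<integral>x. \<phi> x \<partial>\<gamma>)"
proof -
  define N where "N = restrict_space (borel :: 'b measure) K"
  have spN: "space N = K" by (simp add: N_def space_restrict_space)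
  define B where "B b = (if b then return N z else \<gamma>)" for b
  have B: "B \<in> measurable (measure_pmf (bernoulli_pmf t)) (prob_algebra N)"
    using \<gamma> z spN by (auto simp: B_def space_prob_algebra borel_probs_iff N_def prob_space_return)
  have M: "measure_pmf (bernoulli_pmf t) \<in> space (prob_algebra (count_space UNIV))"
    by (simp add: space_prob_algebra measure_pmf.prob_space_axioms)
  have B': "B \<in> measurable (count_space UNIV) (prob_algebra N)"
    using B by (simp cong: measurable_cong_sets)
  define \<gamma>' where "\<gamma>' = measure_pmf (bernoulli_pmf t) \<bind> B"
  have "\<gamma>' \<in> borel_probs K"
    unfolding \<gamma>'_def borel_probs_iff N_def[symmetric]
    using prob_space_bind'[OF M B'] sets_bind'[OF M B'] by simp
  moreover have "(\<integral>x. \<phi> x \<partial>\<gamma>') = t * \<phi> z + (1 - t) * (\<integral>x. \<phi> x \<partial>\<gamma>)"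
    if \<phi>: "continuous_on K \<phi>" for \<phi> :: "'b \<Rightarrow> real"
  proof -
    have m: "\<phi> \<in> borel_measurable N"
      unfolding N_def by (rule borel_measurable_continuous_on_restrict[OF \<phi>])
    obtain C where C: "\<And>x. x \<in> K \<Longrightarrow> norm (\<phi> x) \<le> C"
      using compact_continuous_bounded[OF K \<phi>] by metis
    have "(\<integral>x. \<phi> x \<partial>\<gamma>') = (\<integral>b. (\<integral>x. \<phi> x \<partial>B b) \<partial>measure_pmf (bernoulli_pmf t))"
      unfolding \<gamma>'_def
    proof (rule integral_bind[OF m, where B = C and B' = 1])
      show "\<bar>\<phi> x\<bar> \<le> C" if "x \<in> space N" for x using C that spN by simp
      show "B \<in> measurable (measure_pmf (bernoulli_pmf t)) (subprob_algebra N)"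
        by (rule measurable_prob_algebraD[OF B])
      show "finite_measure (measure_pmf (bernoulli_pmf t))" by (rule measure_pmf.finite_measure_axioms)
      have "prob_space (B b)" for b
        using measurable_space[OF B, of b] by (simp add: space_prob_algebra)
      then show "AE b in measure_pmf (bernoulli_pmf t). emeasure (B b) (space (B b)) \<le> ennreal 1"
        by (simp add: prob_space.emeasure_space_1)
    qed
    also have "\<dots> = t * \<phi> z + (1 - t) * (\<integral>x. \<phi> x \<partial>\<gamma>)"
      using t m z spN by (simp add: B_def integral_return)
    finally show ?thesis .
  qed
  ultimately show thesis using that by blast
qed

lemma quadratic_nonneg_slope:
  fixes P Q :: real
  assumes Q: "Q \<ge> 0" and *: "\<And>t. 0 < t \<Longrightarrow> t < 1 \<Longrightarrow> 0 \<le> 2 * t * P + t\<^sup>2 * Q"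
  shows "P \<ge> 0"
proof (rule ccontr)
  assume "\<not> P \<ge> 0"
  then have P: "P < 0" by simp
  \<comment> \<open>The choice gives \<open>t * Q < - P\<close>, hence
    \<open>2 * P + t * Q < P < 0\<close>; the cap 1/2 keeps \<open>t\<close> inside the unit
    interval.\<close>
  define t where "t = min (1/2) (- P / (Q + 1))"
  have t: "0 < t" "t < 1" using P Q divide_neg_pos[of P "Q + 1"] by (auto simp: t_def)
  have "t * (Q + 1) \<le> - P" using Q by (simp add: t_def pos_le_divide_eq[symmetric])
  then have "2 * P + t * Q < 0" using t P by (simp add: algebra_simps)
  then have "t * (2 * P + t * Q) < 0" using t by (simp add: mult_pos_neg)
  then show False using *[OF t] by (simp add: algebra_simps power2_eq_square)
qed

text \<open>The hypothesis \<open>dual\<close> forbids a linear combination of the moments that is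
  bounded below by a positive constant. This is clearly necessary for a solution; minimality of the
  squared residual shows that it suffices.\<close>

lemma finite_moments_zero:
  fixes K :: "'b::polish_space set" and G :: "nat \<Rightarrow> 'b \<Rightarrow> real"
  assumes K: "compact K" and ne: "K \<noteq> {}"
    and G: "\<And>j. j < m \<Longrightarrow> continuous_on K (G j)"
    and dual: "\<And>a s. (\<And>x. x \<in> K \<Longrightarrow> s \<le> (\<Sum>j<m. a j * G j x)) \<Longrightarrow> s \<le> 0"
  obtains \<gamma> where "\<gamma> \<in> borel_probs K" "\<And>j. j < m \<Longrightarrow> (\<integral>x. G j x \<partial>\<gamma>) = 0"
proof -
  define F where "F \<gamma> = (\<Sum>j<m. (\<integral>x. G j x \<partial>\<gamma>)\<^sup>2)" for \<gamma>
  obtain z0 where z0: "z0 \<in> K" using ne by blast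
  have "return (restrict_space borel K) z0 \<in> borel_probs K"
    using z0 by (auto simp: borel_probs_iff intro!: prob_space_return simp: space_restrict_space)
  then have nonempty: "borel_probs K \<noteq> {}" by blast
  have bdd: "bdd_below (F ` borel_probs K)"
    by (rule bdd_belowI[of _ 0]) (auto simp: F_def intro: sum_nonneg)
  define I where "I = (INF \<gamma>\<in>borel_probs K. F \<gamma>)"
  have "\<exists>\<gamma>\<in>borel_probs K. F \<gamma> < I + 1 / Suc k" for k
    using cINF_less_iff[OF nonempty bdd, of "I + 1 / Suc k"] by (simp add: I_def)
  then obtain \<gamma> where \<gamma>: "\<And>k. \<gamma> k \<in> borel_probs K" "\<And>k. F (\<gamma> k) < I + 1 / Suc k" by metis
  obtain r \<rho> where r: "strict_mono r" and \<rho>: "\<rho> \<in> borel_probs K"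
    and conv: "\<And>\<phi> :: 'b \<Rightarrow> real. continuous_on K \<phi> \<Longrightarrow> (\<lambda>k. \<integral>x. \<phi> x \<partial>\<gamma> (r k)) \<longlonglongrightarrow> (\<integral>x. \<phi> x \<partial>\<rho>)"
    by (rule borel_probs_seq_compact[of K \<gamma>, OF K \<gamma>(1)]) blast
  have "(\<lambda>k. F (\<gamma> (r k))) \<longlonglongrightarrow> F \<rho>"
    unfolding F_def by (intro tendsto_sum tendsto_power conv G) auto
  moreover have "(\<lambda>k. I + 1 / Suc (r k)) \<longlonglongrightarrow> I + 0"
    by (intro tendsto_intros LIMSEQ_subseq_LIMSEQ[OF _ r, unfolded comp_def, of "\<lambda>k. 1 / Suc k"])
      (use lim_1_over_n LIMSEQ_Suc[OF lim_1_over_n] in auto)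
  ultimately have "F \<rho> \<le> I + 0" using \<gamma>(2) by (intro LIMSEQ_le[of _ _ _ "I + 0"]) (auto intro: less_imp_le)
  then have min: "F \<rho> \<le> F \<gamma>" if "\<gamma> \<in> borel_probs K" for \<gamma>
    using cINF_lower[OF bdd that] by (simp add: I_def)
  \<comment> \<open>The residuals at the minimiser also serve as the coefficients handed to
    \<open>dual\<close>.\<close>
  define a where "a j = (\<integral>x. G j x \<partial>\<rho>)" for j
  have "(\<Sum>j<m. (a j)\<^sup>2) \<le> (\<Sum>j<m. a j * G j z)" if z: "z \<in> K" for z
  proof -
    define P where "P = (\<Sum>j<m. a j * (G j z - a j))"
    define Q where "Q = (\<Sum>j<m. (G j z - a j)\<^sup>2)"
    \<comment> \<open>\<open>2 * P\<close> is the derivative of \<open>F\<close> at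
      \<open>\<rho>\<close> towards the point mass at \<open>z\<close>, nonnegative at a minimiser;
      \<open>Q\<close> is the exact quadratic coefficient.\<close>
    have "P \<ge> 0"
    proof (rule quadratic_nonneg_slope)
      show "Q \<ge> 0" unfolding Q_def by (intro sum_nonneg) simp
      fix t :: real assume t: "0 < t" "t < 1"
      obtain \<gamma>' where \<gamma>': "\<gamma>' \<in> borel_probs K"
        "\<And>\<phi> :: 'b \<Rightarrow> real. continuous_on K \<phi> \<Longrightarrow> (\<integral>x. \<phi> x \<partial>\<gamma>') = t * \<phi> z + (1 - t) * (\<integral>x. \<phi> x \<partial>\<rho>)"
        using borel_probs_mixture[OF \<rho> K z, of t] t by (metis less_imp_le)
      have "F \<gamma>' = (\<Sum>j<m. (t * G j z + (1 - t) * a j)\<^sup>2)"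
        unfolding F_def by (intro sum.cong) (use \<gamma>'(2) G a_def in auto)
      also have "\<dots> = (\<Sum>j<m. (a j)\<^sup>2 + 2 * t * (a j * (G j z - a j)) + t\<^sup>2 * (G j z - a j)\<^sup>2)"
        by (intro sum.cong) (auto simp: power2_eq_square algebra_simps)
      also have "\<dots> = F \<rho> + 2 * t * P + t\<^sup>2 * Q"
        by (simp add: sum.distrib P_def Q_def F_def a_def sum_distrib_left)
      finally show "0 \<le> 2 * t * P + t\<^sup>2 * Q" using min[OF \<gamma>'(1)] by simp
    qed
    then show ?thesis by (simp add: P_def right_diff_distrib sum_subtractf power2_eq_square)
  qed
  from dual[OF this] have "(\<Sum>j<m. (a j)\<^sup>2) = 0" by (simp add: antisym sum_nonneg)
  then have "a j = 0" if "j < m" for j using that by (simp add: sum_nonneg_eq_0_iff)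
  then show thesis using that[OF \<rho>] a_def by simp
qed

text \<open>Weak compactness upgrades the solvability of every finite subsystem to that of the whole
  system.\<close>

theorem countable_moments_zero:
  fixes K :: "'b::polish_space set" and G :: "nat \<Rightarrow> 'b \<Rightarrow> real"
  assumes K: "compact K" and ne: "K \<noteq> {}"
    and G: "\<And>j. continuous_on K (G j)"
    and dual: "\<And>m a s. (\<And>x. x \<in> K \<Longrightarrow> s \<le> (\<Sum>j<m. a j * G j x)) \<Longrightarrow> s \<le> 0"
  obtains \<gamma> where "\<gamma> \<in> borel_probs K" "\<And>j. (\<integral>x. G j x \<partial>\<gamma>) = 0"
proof -
  have "\<exists>\<gamma>\<in>borel_probs K. \<forall>j<m. (\<integral>x. G j x \<partial>\<gamma>) = 0" for m :: nat
    using finite_moments_zero[OF K ne, of m G] G dual by metis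
  then obtain \<gamma> where \<gamma>: "\<And>m::nat. \<gamma> m \<in> borel_probs K" "\<And>m j. j < m \<Longrightarrow> (\<integral>x. G j x \<partial>\<gamma> m) = 0"
    by metis
  obtain r \<rho> where r: "strict_mono r" and \<rho>: "\<rho> \<in> borel_probs K"
    and conv: "\<And>\<phi> :: 'b \<Rightarrow> real. continuous_on K \<phi> \<Longrightarrow> (\<lambda>k. \<integral>x. \<phi> x \<partial>\<gamma> (r k)) \<longlonglongrightarrow> (\<integral>x. \<phi> x \<partial>\<rho>)"
    by (rule borel_probs_seq_compact[of K \<gamma>, OF K \<gamma>(1)]) blast
  \<comment> \<open>\<open>\<gamma> m\<close> solves the equations with index below
    \<open>m\<close>, so equation \<open>j\<close> holds along the subsequence once
    \<open>k > j\<close>, because \<open>r k \<ge> k\<close>.\<close>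
  have "(\<integral>x. G j x \<partial>\<rho>) = 0" for j
  proof -
    have "\<forall>\<^sub>F k in sequentially. (\<integral>x. G j x \<partial>\<gamma> (r k)) = 0"
      using eventually_gt_at_top[of j]
      by eventually_elim (use \<gamma>(2) seq_suble[OF r] in \<open>meson less_le_trans\<close>)
    then have "(\<lambda>k. \<integral>x. G j x \<partial>\<gamma> (r k)) \<longlonglongrightarrow> 0" by (rule tendsto_eventually)
    then show ?thesis using conv[OF G] LIMSEQ_unique by blast
  qed
  then show thesis using that \<rho> by blast
qed

section \<open>Regular conditional distributions\<close>

text \<open>\<open>k\<close> composed with \<open>X\<close> is a version of the conditional
  probability of \<open>E\<close> given \<open>X\<close>. It is a Radon-Nikodym density: the law of
  \<open>X\<close> restricted to \<open>E\<close> is dominated by the law of \<open>X\<close>. The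
  bounds hold everywhere, not only almost everywhere, so that no exceptional set has to be carried
  along for them.\<close>

lemma (in prob_space) conditional_probability_exists:
  assumes X[measurable]: "X \<in> measurable M N" and E[measurable]: "E \<in> sets M"
  obtains k :: "'b \<Rightarrow> real" where "k \<in> borel_measurable N" "\<And>x. 0 \<le> k x" "\<And>x. k x \<le> 1"
    "\<And>A. A \<in> sets N \<Longrightarrow> emeasure M (X -` A \<inter> space M \<inter> E) = (\<integral>\<^sup>+x\<in>A. ennreal (k x) \<partial>distr M N X)"
proof -
  define \<mu> where "\<mu> = distr M N X"
  have [measurable_cong]: "sets \<mu> = sets N" by (simp add: \<mu>_def)
  interpret \<mu>: prob_space \<mu> unfolding \<mu>_def by (rule prob_space_distr[OF X])
  have ex: "\<exists>f\<in>borel_measurable N. \<forall>A\<in>sets N.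
      emeasure M (X -` A \<inter> space M \<inter> F) = (\<integral>\<^sup>+x\<in>A. f x \<partial>\<mu>)" if [measurable]: "F \<in> sets M" for F
  proof -
    define \<nu> where "\<nu> = distr (density M (indicator F)) N X"
    have \<nu>: "emeasure \<nu> A = emeasure M (X -` A \<inter> space M \<inter> F)" if [measurable]: "A \<in> sets N" for A
    proof -
      have "emeasure \<nu> A = emeasure (density M (indicator F)) (X -` A \<inter> space M)"
        by (simp add: \<nu>_def emeasure_distr)
      also have "\<dots> = emeasure M (F \<inter> (X -` A \<inter> space M))" by (rule emeasure_restricted) auto
      finally show ?thesis by (simp add: Int_commute)
    qed
    have "absolutely_continuous \<mu> \<nu>"
      unfolding absolutely_continuous_def null_sets_def
    proof safe
      fix A assume A: "A \<in> sets \<mu>" "emeasure \<mu> A = 0"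
      then have [measurable]: "A \<in> sets N" by (simp add: \<mu>_def)
      have "emeasure \<nu> A \<le> emeasure \<mu> A"
        by (auto simp: \<nu> \<mu>_def emeasure_distr intro!: emeasure_mono)
      then show "emeasure \<nu> A = 0" using A by simp
    qed (simp add: \<mu>_def \<nu>_def)
    then obtain f where f: "f \<in> borel_measurable \<mu>" "density \<mu> f = \<nu>"
      using \<mu>.Radon_Nikodym[of \<nu>] by (auto simp: \<mu>_def \<nu>_def)
    have "emeasure \<nu> A = (\<integral>\<^sup>+x\<in>A. f x \<partial>\<mu>)" if "A \<in> sets N" for A
      using f that by (subst f(2)[symmetric], subst emeasure_density) (auto simp: \<mu>_def)
    then show ?thesis using f \<nu> by (auto simp: \<mu>_def)
  qed
  obtain f where f[measurable]: "f \<in> borel_measurable N" and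
    fE: "\<And>A. A \<in> sets N \<Longrightarrow> emeasure M (X -` A \<inter> space M \<inter> E) = (\<integral>\<^sup>+x\<in>A. f x \<partial>\<mu>)"
    using ex[OF E] by blast
  \<comment> \<open>The density for the complement of \<open>E\<close> shows
    \<open>f \<le> 1\<close> almost everywhere, since the two densities add up to 1. Truncation then
    changes \<open>f\<close> only on a null set.\<close>
  obtain g where g[measurable]: "g \<in> borel_measurable N" and
    gE: "\<And>A. A \<in> sets N \<Longrightarrow> emeasure M (X -` A \<inter> space M \<inter> (space M - E)) = (\<integral>\<^sup>+x\<in>A. g x \<partial>\<mu>)"
    using ex[of "space M - E"] by auto
  have "AE x in \<mu>. f x + g x = 1"
  proof (rule \<mu>.density_unique_finite_measure)
    fix A assume A: "A \<in> sets \<mu>"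
    then have [measurable]: "A \<in> sets N" by (simp add: \<mu>_def)
    have "(\<integral>\<^sup>+x\<in>A. (f x + g x) \<partial>\<mu>) = (\<integral>\<^sup>+x\<in>A. f x \<partial>\<mu>) + (\<integral>\<^sup>+x\<in>A. g x \<partial>\<mu>)"
      by (simp add: distrib_right nn_integral_add)
    also have "\<dots> = emeasure M (X -` A \<inter> space M \<inter> E) + emeasure M (X -` A \<inter> space M \<inter> (space M - E))"
      by (simp add: fE gE)
    also have "\<dots> = emeasure M ((X -` A \<inter> space M \<inter> E) \<union> (X -` A \<inter> space M \<inter> (space M - E)))"
      by (rule plus_emeasure) auto
    also have "(X -` A \<inter> space M \<inter> E) \<union> (X -` A \<inter> space M \<inter> (space M - E)) = X -` A \<inter> space M" by auto
    also have "emeasure M \<dots> = (\<integral>\<^sup>+x\<in>A. 1 \<partial>\<mu>)" by (simp add: \<mu>_def emeasure_distr)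
    finally show "(\<integral>\<^sup>+x\<in>A. (f x + g x) \<partial>\<mu>) = (\<integral>\<^sup>+x\<in>A. 1 \<partial>\<mu>)" .
  qed auto
  then have f_le: "AE x in \<mu>. f x = ennreal (min 1 (enn2real (f x)))"
  proof eventually_elim
    case (elim x)
    then have "f x \<le> 1" by (metis le_iff_add)
    then have "f x < top" by (simp add: order_le_less_trans)
    then have "f x = ennreal (enn2real (f x))" by simp
    moreover have "enn2real (f x) \<le> 1" using \<open>f x \<le> 1\<close> enn2real_mono[of "f x" 1] by simp
    ultimately show ?case by simp
  qed
  show thesis
  proof
    show "(\<lambda>x. min 1 (enn2real (f x))) \<in> borel_measurable N" by measurable
    fix A assume [measurable]: "A \<in> sets N"
    have "(\<integral>\<^sup>+x\<in>A. ennreal (min 1 (enn2real (f x))) \<partial>\<mu>) = (\<integral>\<^sup>+x\<in>A. f x \<partial>\<mu>)"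
      by (rule nn_integral_cong_AE) (use f_le in \<open>eventually_elim, simp\<close>)
    then show "emeasure M (X -` A \<inter> space M \<inter> E) = (\<integral>\<^sup>+x\<in>A. ennreal (min 1 (enn2real (f x))) \<partial>distr M N X)"
      by (simp add: fE \<mu>_def)
  qed auto
qed

text \<open>Conditional probabilities can be controlled at only countably many points at once, so
  the data are a monotone function on the rationals. The infimum over larger rationals forces right
  continuity, and the thresholds \<open>lo\<close> and \<open>hi\<close> supply the limits at both
  ends.\<close>

lemma interval_measure_rational_cdf:
  fixes H :: "rat \<Rightarrow> real" and lo hi :: real
  assumes mono: "\<And>q q'. q \<le> q' \<Longrightarrow> H q \<le> H q'"
    and H0: "\<And>q. of_rat q < lo \<Longrightarrow> H q = 0" and H1: "\<And>q. hi \<le> of_rat q \<Longrightarrow> H q = 1"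
    and F: "\<And>t. F t = (INF q\<in>{q. t < of_rat q}. H q)"
  shows "real_distribution (interval_measure F)"
    "emeasure (interval_measure F) {..t} = ennreal (F t)"
proof -
  obtain ql :: rat where ql: "of_rat ql < lo" using of_rat_dense[of "lo - 1" lo] by auto
  obtain qh :: rat where qh: "hi < of_rat qh" using of_rat_dense[of hi "hi + 1"] by auto
  have ge0: "0 \<le> H q" for q
  proof -
    have "(of_rat (min q ql) :: real) \<le> of_rat ql" by (simp add: of_rat_less_eq)
    then have "H (min q ql) = 0" using ql by (intro H0) linarith
    then show ?thesis using mono[of "min q ql" q] by simp
  qed
  have le1: "H q \<le> 1" for q
  proof -
    have "(of_rat qh :: real) \<le> of_rat (max q qh)" by (simp add: of_rat_less_eq)
    then have "H (max q qh) = 1" using qh by (intro H1) linarith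
    then show ?thesis using mono[of q "max q qh"] by simp
  qed
  have ne: "{q::rat. t < of_rat q} \<noteq> {}" for t :: real
    using of_rat_dense[of t "t + 1"] by auto
  have bdd: "bdd_below (H ` Q)" for Q by (rule bdd_belowI2[of _ 0]) (rule ge0)
  have F_le: "F t \<le> H q" if "t < of_rat q" for t q
    unfolding F by (rule cINF_lower[OF bdd]) (use that in simp)
  have F_ge: "v \<le> F t" if "\<And>q. t < of_rat q \<Longrightarrow> v \<le> H q" for v t
    unfolding F by (rule cINF_greatest[OF ne]) (use that in simp)
  have F_less: "\<exists>q. t < of_rat q \<and> H q < v" if "F t < v" for t v
    using F_ge[of t v] that by fastforce
  have F_mono: "F s \<le> F t" if "s \<le> t" for s t
    by (rule F_ge, rule F_le) (use that in auto)
  have F_le1: "F t \<le> 1" for t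
  proof -
    obtain q where "t < of_rat q" using ne[of t] by blast
    then show ?thesis using F_le[of t q] le1[of q] by simp
  qed
  have rc: "continuous (at_right t) F" for t
    unfolding continuous_within
  proof (rule order_tendstoI)
    fix v assume "v < F t"
    show "\<forall>\<^sub>F s in at_right t. v < F s"
      by (rule eventually_mono[OF eventually_at_right_less]) (rule less_le_trans[OF \<open>v < F t\<close> F_mono], simp)
  next
    fix v assume "F t < v"
    then obtain q where q: "t < of_rat q" "H q < v" using F_less by blast
    show "\<forall>\<^sub>F s in at_right t. F s < v"
      unfolding eventually_at_right_field
    proof (intro exI conjI allI impI)
      show "t < of_rat q" by (rule q)
      show "F s < v" if "s < of_rat q" for s using F_le[OF that] q(2) by simp
    qed
  qed
  have F0: "F t = 0" if t: "t < lo" for t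
  proof -
    obtain q :: rat where "t < of_rat q" "of_rat q < lo" using of_rat_dense[OF t] by auto
    then have "F t \<le> 0" using F_le[of t q] H0[of q] by simp
    moreover have "0 \<le> F t" by (rule F_ge) (rule ge0)
    ultimately show ?thesis by simp
  qed
  have F1: "F t = 1" if "hi \<le> t" for t
  proof (rule antisym)
    show "F t \<le> 1" by (rule F_le1)
    show "1 \<le> F t" by (rule F_ge) (use H1 that in auto)
  qed
  have l0: "(F \<longlongrightarrow> 0) at_bot"
    by (rule tendsto_eventually, rule eventually_at_bot_dense[THEN iffD2]) (use F0 in blast)
  have l1: "(F \<longlongrightarrow> 1) at_top"
    by (rule tendsto_eventually, rule eventually_at_top_linorder[THEN iffD2]) (use F1 in blast)
  show rd: "real_distribution (interval_measure F)"
    by (rule real_distribution_interval_measure[OF F_mono rc l0 l1])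
  interpret real_distribution "interval_measure F" by fact
  have "cdf (interval_measure F) = F" by (rule cdf_interval_measure[OF F_mono rc l0])
  then show "emeasure (interval_measure F) {..t} = ennreal (F t)" for t
    by (simp add: emeasure_eq_measure cdf_def fun_eq_iff)
qed

text \<open>The kernel is built from its cdf: monotonicity and normalisation of the conditional
  probabilities of rational half lines each hold off a null set, and countably many null sets
  combine into one.\<close>

theorem (in prob_space) real_regular_conditional_distribution:
  assumes X[measurable]: "X \<in> measurable M N" and Y[measurable]: "Y \<in> borel_measurable M"
    and bd: "\<And>\<omega>. \<omega> \<in> space M \<Longrightarrow> lo \<le> Y \<omega> \<and> Y \<omega> \<le> (hi::real)"
  obtains \<kappa> where "\<kappa> \<in> measurable N (prob_algebra borel)"
    "\<And>A B. A \<in> sets N \<Longrightarrow> B \<in> sets borel \<Longrightarrow>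
       emeasure M (X -` A \<inter> Y -` B \<inter> space M) = (\<integral>\<^sup>+x\<in>A. emeasure (\<kappa> x) B \<partial>distr M N X)"
proof -
  define \<mu> where "\<mu> = distr M N X"
  have [measurable_cong]: "sets \<mu> = sets N" by (simp add: \<mu>_def)
  have sp\<mu>: "space \<mu> = space N" by (simp add: \<mu>_def)
  interpret \<mu>: prob_space \<mu> unfolding \<mu>_def by (rule prob_space_distr[OF X])
  have "lo \<le> hi" using bd not_empty by force
  define ev where "ev S = Y -` S \<inter> space M" for S
  have ev_sets[measurable]: "S \<in> sets borel \<Longrightarrow> ev S \<in> sets M" for S
    unfolding ev_def by (rule measurable_sets[OF Y])
  have "\<forall>S\<in>sets borel. \<exists>k. k \<in> borel_measurable N \<and> (\<forall>x. 0 \<le> k x \<and> k x \<le> 1) \<and>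
    (\<forall>A\<in>sets N. emeasure M (X -` A \<inter> space M \<inter> ev S) = (\<integral>\<^sup>+x\<in>A. ennreal (k x) \<partial>\<mu>))"
  proof
    fix S :: "real set" assume "S \<in> sets borel"
    then show "\<exists>k. k \<in> borel_measurable N \<and> (\<forall>x. 0 \<le> k x \<and> k x \<le> 1) \<and>
      (\<forall>A\<in>sets N. emeasure M (X -` A \<inter> space M \<inter> ev S) = (\<integral>\<^sup>+x\<in>A. ennreal (k x) \<partial>\<mu>))"
      unfolding \<mu>_def by (rule conditional_probability_exists[OF X ev_sets]) blast
  qed
  from bchoice[OF this] obtain k where kk: "\<And>S. S \<in> sets borel \<Longrightarrow>
      k S \<in> borel_measurable N \<and> (\<forall>x. 0 \<le> k S x \<and> k S x \<le> 1) \<and>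
      (\<forall>A\<in>sets N. emeasure M (X -` A \<inter> space M \<inter> ev S) = (\<integral>\<^sup>+x\<in>A. ennreal (k S x) \<partial>\<mu>))"
    by blast
  then have k[measurable]: "k S \<in> borel_measurable N"
    and k01: "0 \<le> k S x" "k S x \<le> 1"
    and kE: "A \<in> sets N \<Longrightarrow> emeasure M (X -` A \<inter> space M \<inter> ev S) = (\<integral>\<^sup>+x\<in>A. ennreal (k S x) \<partial>\<mu>)"
    if "S \<in> sets borel" for S A x
    using that by blast+
  have k_add: "AE x in \<mu>. k (S \<union> T) x = k S x + k T x"
    if [measurable]: "S \<in> sets borel" "T \<in> sets borel" and disj: "S \<inter> T = {}" for S T
  proof -
    have "AE x in \<mu>. ennreal (k (S \<union> T) x) = ennreal (k S x) + ennreal (k T x)"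
    proof (rule \<mu>.density_unique_finite_measure)
      fix A assume "A \<in> sets \<mu>"
      then have [measurable]: "A \<in> sets N" by (simp add: \<mu>_def)
      have "(\<integral>\<^sup>+x\<in>A. ennreal (k (S \<union> T) x) \<partial>\<mu>) = emeasure M (X -` A \<inter> space M \<inter> ev (S \<union> T))"
        by (simp add: kE)
      also have "X -` A \<inter> space M \<inter> ev (S \<union> T) = (X -` A \<inter> space M \<inter> ev S) \<union> (X -` A \<inter> space M \<inter> ev T)"
        by (auto simp: ev_def)
      also have "emeasure M \<dots> = emeasure M (X -` A \<inter> space M \<inter> ev S) + emeasure M (X -` A \<inter> space M \<inter> ev T)"
        by (rule plus_emeasure[symmetric]) (use disj in \<open>auto simp: ev_def\<close>)
      also have "\<dots> = (\<integral>\<^sup>+x\<in>A. (ennreal (k S x) + ennreal (k T x)) \<partial>\<mu>)"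
        by (simp add: kE distrib_right nn_integral_add)
      finally show "(\<integral>\<^sup>+x\<in>A. ennreal (k (S \<union> T) x) \<partial>\<mu>) = (\<integral>\<^sup>+x\<in>A. (ennreal (k S x) + ennreal (k T x)) \<partial>\<mu>)" .
    qed auto
    then show ?thesis by eventually_elim (simp add: k01 flip: ennreal_plus)
  qed
  have k_null: "AE x in \<mu>. k S x = 0" if [measurable]: "S \<in> sets borel" and "ev S = {}" for S
  proof -
    have "(\<integral>\<^sup>+x. ennreal (k S x) \<partial>\<mu>) = 0"
      using kE[OF that(1) sets.top] that(2) by (simp add: sp\<mu>[symmetric] cong: nn_integral_cong)
    then show ?thesis by (subst (asm) nn_integral_0_iff_AE) (auto simp: k01 antisym)
  qed
  have k_one: "AE x in \<mu>. k S x = 1" if [measurable]: "S \<in> sets borel" and "ev S = space M" for S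
  proof -
    have "AE x in \<mu>. ennreal (k S x) = 1"
    proof (rule \<mu>.density_unique_finite_measure)
      fix A assume "A \<in> sets \<mu>"
      then have [measurable]: "A \<in> sets N" by (simp add: \<mu>_def)
      have "(\<integral>\<^sup>+x\<in>A. ennreal (k S x) \<partial>\<mu>) = emeasure M (X -` A \<inter> space M)"
        using kE[OF that(1), of A] that(2) by simp
      then show "(\<integral>\<^sup>+x\<in>A. ennreal (k S x) \<partial>\<mu>) = (\<integral>\<^sup>+x\<in>A. 1 \<partial>\<mu>)" by (simp add: \<mu>_def emeasure_distr)
    qed auto
    then show ?thesis by eventually_elim simp
  qed
  define h where "h q = k {..of_rat q}" for q :: rat
  have h[measurable]: "h q \<in> borel_measurable N" for q unfolding h_def by measurable
  define good where "good x \<longleftrightarrow> (\<forall>q q'. q \<le> q' \<longrightarrow> h q x \<le> h q' x) \<and>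
     (\<forall>q. of_rat q < lo \<longrightarrow> h q x = 0) \<and> (\<forall>q. hi \<le> of_rat q \<longrightarrow> h q x = 1)" for x
  have [measurable]: "Measurable.pred N good" unfolding good_def[abs_def] by measurable
  have AE_good: "AE x in \<mu>. good x"
    unfolding good_def AE_conj_iff AE_all_countable
  proof (intro conjI allI)
    fix q q' :: rat
    show "AE x in \<mu>. q \<le> q' \<longrightarrow> h q x \<le> h q' x"
    proof (cases "q \<le> q'")
      case True
      have "{..real_of_rat q} \<union> {of_rat q<..of_rat q'} = {..of_rat q'}"
        using True by (intro ivl_disj_un_one) (simp add: of_rat_less_eq)
      moreover have "{..real_of_rat q} \<inter> {of_rat q<..of_rat q'} = {}" by auto
      ultimately have "AE x in \<mu>. h q' x = h q x + k {of_rat q<..of_rat q'} x"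
        unfolding h_def using k_add[of "{..of_rat q}" "{of_rat q<..of_rat q'}"] by (metis atMost_borel greaterThanAtMost_borel)
      then show ?thesis by eventually_elim (simp add: k01)
    qed simp
    show "AE x in \<mu>. of_rat q < lo \<longrightarrow> h q x = 0"
    proof (cases "of_rat q < lo")
      case True
      then have "ev {..of_rat q} = {}" using bd by (force simp: ev_def)
      then show ?thesis using k_null[of "{..of_rat q}"] by (simp add: h_def)
    qed simp
    show "AE x in \<mu>. hi \<le> of_rat q \<longrightarrow> h q x = 1"
    proof (cases "hi \<le> of_rat q")
      case True
      then have "ev {..of_rat q} = space M" using bd by (force simp: ev_def)
      then show ?thesis using k_one[of "{..of_rat q}"] by (simp add: h_def)
    qed simp
  qed
  \<comment> \<open>Off the good set the rational values are those of the point mass at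
    \<open>lo\<close>, so that every \<open>x\<close> yields a probability measure.\<close>
  define H where "H x q = (if good x then h q x else if lo \<le> of_rat q then 1 else 0)" for x q
  have H_meas[measurable]: "(\<lambda>x. H x q) \<in> borel_measurable N" for q unfolding H_def by measurable
  have H_mono: "H x q \<le> H x q'" if q: "q \<le> q'" for x q q'
  proof (cases "good x")
    case True
    then have "h q x \<le> h q' x" using q unfolding good_def by blast
    then show ?thesis using True by (simp add: H_def)
  next
    case False
    moreover have "real_of_rat q \<le> of_rat q'" using q by (simp add: of_rat_less_eq)
    ultimately show ?thesis by (simp add: H_def)
  qed
  have H0: "H x q = 0" if "of_rat q < lo" for x q
  proof (cases "good x")
    case True
    then have "h q x = 0" using that unfolding good_def by blast
    then show ?thesis using True by (simp add: H_def)
  qed (use that in \<open>simp add: H_def\<close>)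
  have H1: "H x q = 1" if "hi \<le> of_rat q" for x q
  proof (cases "good x")
    case True
    then have "h q x = 1" using that unfolding good_def by blast
    then show ?thesis using True by (simp add: H_def)
  qed (use that \<open>lo \<le> hi\<close> in \<open>simp add: H_def\<close>)
  define F where "F x t = (INF q\<in>{q. t < of_rat q}. H x q)" for x and t :: real
  note Fp = interval_measure_rational_cdf[of "H x" lo hi "F x" for x, OF H_mono H0 H1 F_def]
  have H01: "0 \<le> H x q" "H x q \<le> 1" for x q
    using k01[of "{..of_rat q}"] by (auto simp: H_def h_def)
  have F_meas[measurable]: "(\<lambda>x. F x t) \<in> borel_measurable N" for t
    unfolding F_def by (intro borel_measurable_cINF bdd_belowI2[where m = 0]) (auto simp: H01)
  define \<kappa> where "\<kappa> x = interval_measure (F x)" for x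
  have \<kappa>_rd: "real_distribution (\<kappa> x)" for x unfolding \<kappa>_def by (rule Fp)
  have gen: "sets (borel :: real measure) = sigma_sets UNIV (range (\<lambda>a. {..a}))"
    by (subst borel_eq_atMost) simp
  have Ist: "Int_stable (range (\<lambda>a::real. {..a}))"
    by (auto simp: Int_stable_def)
  have \<kappa>: "\<kappa> \<in> measurable N (prob_algebra borel)"
  proof (rule measurable_prob_algebra_generated[OF gen Ist])
    show "prob_space (\<kappa> x)" "sets (\<kappa> x) = sets borel" for x
      using \<kappa>_rd[of x] by (auto simp: real_distribution_def real_distribution_axioms_def)
    fix A assume "A \<in> range (\<lambda>a::real. {..a})"
    then show "(\<lambda>x. emeasure (\<kappa> x) A) \<in> borel_measurable N" by (auto simp: \<kappa>_def Fp)
  qed simp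
  \<comment> \<open>Both sides are approached from the right of \<open>t\<close> through rationals:
    the cdf values by the infimum that defines \<open>F\<close>, the events because an
    \<open>\<omega>\<close> with \<open>Y \<omega> > t\<close> drops out once
    \<open>q n < Y \<omega>\<close>.\<close>
  have half: "emeasure M (X -` A \<inter> space M \<inter> ev {..t}) = (\<integral>\<^sup>+x\<in>A. ennreal (F x t) \<partial>\<mu>)"
    if A[measurable]: "A \<in> sets N" for A t
  proof -
    have "\<exists>q::rat. t < of_rat q \<and> of_rat q < t + 1 / Suc n" for n
      using of_rat_dense[of t "t + 1 / Suc n"] by auto
    then obtain q :: "nat \<Rightarrow> rat" where q: "\<And>n. t < of_rat (q n)" "\<And>n. of_rat (q n) < t + 1 / Suc n"
      by metis
    have ev_q: "\<forall>\<^sub>F n in sequentially. of_rat (q n) < v" if "t < v" for v :: real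
    proof -
      have "\<forall>\<^sub>F n in sequentially. 1 / real (Suc n) < v - t"
        using order_tendstoD(2)[OF LIMSEQ_Suc[OF lim_1_over_n], of "v - t"] that by simp
      then show ?thesis by eventually_elim (use q(2) in \<open>smt (verit)\<close>)
    qed
    have Hlim: "(\<lambda>n. H x (q n)) \<longlonglongrightarrow> F x t" for x
    proof (rule order_tendstoI)
      have le: "F x t \<le> H x q'" if "t < of_rat q'" for q'
        unfolding F_def using that by (intro cINF_lower bdd_belowI2[where m = 0]) (auto simp: H01)
      fix v assume "v < F x t"
      then show "\<forall>\<^sub>F n in sequentially. v < H x (q n)" 
        by (intro always_eventually allI less_le_trans[OF _ le[OF q(1)]])
    next
      fix v assume v: "F x t < v"
      have "\<exists>q'. t < of_rat q' \<and> H x q' < v"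
      proof (rule ccontr)
        assume *: "\<nexists>q'. t < of_rat q' \<and> H x q' < v"
        have "v \<le> F x t" unfolding F_def
        proof (rule cINF_greatest)
          show "{q::rat. t < of_rat q} \<noteq> {}" using of_rat_dense[of t "t+1"] by auto
          show "v \<le> H x q'" if "q' \<in> {q. t < of_rat q}" for q' using * that by (force simp: not_less)
        qed
        then show False using v by simp
      qed
      then obtain q' where q': "t < of_rat q'" "H x q' < v" by blast
      show "\<forall>\<^sub>F n in sequentially. H x (q n) < v"
        using ev_q[OF q'(1)]
      proof eventually_elim
        case (elim n)
        then have "q n \<le> q'" by (simp add: of_rat_less)
        then show ?case using H_mono[of "q n" q' x] q'(2) by simp
      qed
    qed
    have "(\<integral>\<^sup>+x\<in>A. ennreal (H x (q n)) \<partial>\<mu>) = emeasure M (X -` A \<inter> space M \<inter> ev {..of_rat (q n)})" for n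
    proof -
      have "(\<integral>\<^sup>+x\<in>A. ennreal (H x (q n)) \<partial>\<mu>) = (\<integral>\<^sup>+x\<in>A. ennreal (h (q n) x) \<partial>\<mu>)"
        by (rule nn_integral_cong_AE) (use AE_good in \<open>eventually_elim, simp add: H_def\<close>)
      then show ?thesis by (simp add: kE h_def)
    qed
    moreover have "(\<lambda>n. \<integral>\<^sup>+x\<in>A. ennreal (H x (q n)) \<partial>\<mu>) \<longlonglongrightarrow> (\<integral>\<^sup>+x\<in>A. ennreal (F x t) \<partial>\<mu>)"
    proof (rule nn_integral_dominated_convergence[where w = "\<lambda>_. 1"])
      show "AE x in \<mu>. ennreal (H x (q n)) * indicator A x \<le> 1" for n
        by (intro AE_I2) (auto simp: H01 indicator_def)
      show "AE x in \<mu>. (\<lambda>n. ennreal (H x (q n)) * indicator A x) \<longlonglongrightarrow> ennreal (F x t) * indicator A x"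
        by (intro AE_I2) (auto simp: indicator_def intro!: tendsto_ennrealI Hlim)
    qed (auto simp: \<mu>.emeasure_space_1)
    moreover have "(\<lambda>n. emeasure M (X -` A \<inter> space M \<inter> ev {..of_rat (q n)})) \<longlonglongrightarrow> emeasure M (X -` A \<inter> space M \<inter> ev {..t})"
    proof -
      define E where "E S = X -` A \<inter> space M \<inter> ev S" for S
      have [measurable]: "E S \<in> sets M" if "S \<in> sets borel" for S
        unfolding E_def using measurable_sets[OF X A] ev_sets[OF that] by (rule sets.Int)
      have "(\<lambda>n. \<integral>\<^sup>+\<omega>. indicator (E {..of_rat (q n)}) \<omega> \<partial>M) \<longlonglongrightarrow> (\<integral>\<^sup>+\<omega>. indicator (E {..t}) \<omega> \<partial>M)"
      proof (rule nn_integral_dominated_convergence[where w = "\<lambda>_. 1"])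
        show "AE \<omega> in M. (\<lambda>n. indicator (E {..of_rat (q n)}) \<omega> :: ennreal) \<longlonglongrightarrow> indicator (E {..t}) \<omega>"
        proof (intro AE_I2 tendsto_eventually)
          fix \<omega> assume "\<omega> \<in> space M"
          show "\<forall>\<^sub>F n in sequentially. (indicator (E {..of_rat (q n)}) \<omega> :: ennreal) = indicator (E {..t}) \<omega>"
          proof (cases "Y \<omega> \<le> t")
            case True
            then show ?thesis using q(1) by (auto simp: E_def ev_def indicator_def intro!: always_eventually intro: less_imp_le order_trans)
          next
            case False
            then have "t < Y \<omega>" by simp
            from ev_q[OF this] show ?thesis
            proof eventually_elim
              case (elim n)
              then show ?case using False by (simp add: E_def ev_def indicator_def)
            qed
          qed
        qed
      qed (auto simp: emeasure_space_1 indicator_def)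
      then show ?thesis by (simp add: E_def[symmetric])
    qed
    ultimately show ?thesis using LIMSEQ_unique by simp
  qed
  have "emeasure M (X -` A \<inter> Y -` B \<inter> space M) = (\<integral>\<^sup>+x\<in>A. emeasure (\<kappa> x) B \<partial>\<mu>)"
    if A[measurable]: "A \<in> sets N" and B[measurable]: "B \<in> sets borel" for A B
  proof -
    \<comment> \<open>For fixed \<open>A\<close> both sides are finite measures in \<open>B\<close>,
      so agreement on half lines, which is \<open>half\<close>, determines them.\<close>
    define m1 where "m1 = distr (density M (indicator (X -` A \<inter> space M))) borel Y"
    define m2 where "m2 = density \<mu> (indicator A) \<bind> \<kappa>"
    have \<kappa>_sub: "\<kappa> \<in> measurable (density \<mu> (indicator A)) (subprob_algebra borel)"
      using measurable_prob_algebraD[OF \<kappa>] by (simp cong: measurable_cong_sets)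
    have ne: "space (density \<mu> (indicator A)) \<noteq> {}" using \<mu>.not_empty by simp
    have m1: "emeasure m1 S = emeasure M (X -` A \<inter> space M \<inter> ev S)" if [measurable]: "S \<in> sets borel" for S
    proof -
      have "emeasure m1 S = emeasure (density M (indicator (X -` A \<inter> space M))) (ev S)"
        by (simp add: m1_def emeasure_distr ev_def)
      also have "\<dots> = emeasure M (X -` A \<inter> space M \<inter> ev S)" by (rule emeasure_restricted) auto
      finally show ?thesis .
    qed
    have \<kappa>E[measurable]: "(\<lambda>x. emeasure (\<kappa> x) S) \<in> borel_measurable N" if "S \<in> sets borel" for S
      using measurable_prob_algebraD[OF \<kappa>] that by (rule measurable_emeasure_kernel)
    have m2: "emeasure m2 S = (\<integral>\<^sup>+x\<in>A. emeasure (\<kappa> x) S \<partial>\<mu>)" if [measurable]: "S \<in> sets borel" for S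
    proof -
      have "emeasure m2 S = (\<integral>\<^sup>+x. emeasure (\<kappa> x) S \<partial>density \<mu> (indicator A))"
        unfolding m2_def by (rule emeasure_bind[OF ne \<kappa>_sub]) fact
      also have "\<dots> = (\<integral>\<^sup>+x\<in>A. emeasure (\<kappa> x) S \<partial>\<mu>)"
        by (subst nn_integral_density) (auto simp: mult.commute)
      finally show ?thesis .
    qed
    have "m1 = m2"
    proof (rule measure_eqI_generator_eq[OF Ist, where A = "\<lambda>n. {..real n}"])
      show "sets m1 = sigma_sets UNIV (range (\<lambda>a. {..a}))" by (simp add: m1_def gen[symmetric])
      show "sets m2 = sigma_sets UNIV (range (\<lambda>a. {..a}))"
        unfolding m2_def using sets_bind[of "density \<mu> (indicator A)" \<kappa> borel] ne \<kappa>_sub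
        by (simp add: gen[symmetric] subprob_measurableD(2))
      show "(\<Union>n. {..real n}) = UNIV" by (auto intro: real_arch_simple)
      show "emeasure m1 {..real n} \<noteq> \<infinity>" for n by (simp add: m1)
      fix S assume "S \<in> range (\<lambda>a::real. {..a})"
      then show "emeasure m1 S = emeasure m2 S"
        by (auto simp: m1 m2 half \<kappa>_def Fp)
    qed auto
    then have "emeasure m1 B = emeasure m2 B" by simp
    moreover have "X -` A \<inter> space M \<inter> ev B = X -` A \<inter> Y -` B \<inter> space M" by (auto simp: ev_def)
    ultimately show ?thesis by (simp add: m1 m2)
  qed
  then show thesis using that[OF \<kappa>] by (simp add: \<mu>_def)
qed

text \<open>The real code \<open>g (Z \<omega>)\<close> is conditioned and its kernel decoded. Since
  \<open>f'\<close> inverts \<open>g\<close> on \<open>K\<close>, the event that \<open>Z\<close>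
  lies in \<open>B\<close> is the event that the code lies in the preimage of \<open>B\<close> under
  \<open>f'\<close>.\<close>

theorem (in prob_space) regular_conditional_distribution:
  fixes K :: "'c::polish_space set"
  assumes X[measurable]: "X \<in> measurable M N" and Z[measurable]: "Z \<in> measurable M (restrict_space borel K)"
    and K: "compact K"
  obtains \<kappa> where "\<kappa> \<in> measurable N (prob_algebra (restrict_space borel K))"
    "distr M (N \<Otimes>\<^sub>M restrict_space borel K) (\<lambda>\<omega>. (X \<omega>, Z \<omega>)) =
       distr M N X \<bind> (\<lambda>x. distr (\<kappa> x) (N \<Otimes>\<^sub>M restrict_space borel K) (\<lambda>y. (x, y)))"
proof -
  define L where "L = restrict_space (borel :: 'c measure) K"
  have spL: "space L = K" by (simp add: L_def space_restrict_space)
  have Z'[measurable]: "Z \<in> measurable M L" using Z by (simp add: L_def)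
  define \<mu> where "\<mu> = distr M N X"
  have [measurable_cong]: "sets \<mu> = sets N" by (simp add: \<mu>_def)
  interpret \<mu>: prob_space \<mu> unfolding \<mu>_def by (rule prob_space_distr[OF X])
  obtain g :: "'c \<Rightarrow> real" and f :: "real \<Rightarrow> 'c" and C :: "real set"
    where g: "g \<in> borel_measurable borel" and C: "compact C" and f: "continuous_on C f" "f ` C \<subseteq> K"
    and gC: "g ` K \<subseteq> C" and fg: "\<And>x. x \<in> K \<Longrightarrow> f (g x) = x"
    by (rule compact_borel_coding[OF K]) blast
  obtain \<omega>0 where "\<omega>0 \<in> space M" using not_empty by blast
  then have k0: "Z \<omega>0 \<in> K" using measurable_space[OF Z'] spL by blast
  define f' where "f' t = (if t \<in> C then f t else Z \<omega>0)" for t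
  have [measurable]: "C \<in> sets borel" using C by (intro borel_closed compact_imp_closed)
  have f'[measurable]: "f' \<in> measurable borel L"
    unfolding L_def
  proof (rule measurable_restrict_space2)
    show "f' \<in> space borel \<rightarrow> K" using f(2) k0 by (force simp: f'_def)
    show "f' \<in> measurable borel borel" unfolding f'_def
      by (rule measurable_If_restrict_space_iff[THEN iffD2])
        (auto intro: borel_measurable_continuous_on_restrict[OF f(1)])
  qed
  have gL[measurable]: "g \<in> borel_measurable L" unfolding L_def by (rule measurable_restrict_space1[OF g])
  obtain b where b: "\<And>t. t \<in> C \<Longrightarrow> \<bar>t\<bar> \<le> b"
    using compact_imp_bounded[OF C] unfolding bounded_iff by auto
  have ZK: "Z \<omega> \<in> K" if "\<omega> \<in> space M" for \<omega> using measurable_space[OF Z' that] spL by simp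
  have gZ_bd: "- b \<le> g (Z \<omega>) \<and> g (Z \<omega>) \<le> b" if "\<omega> \<in> space M" for \<omega>
  proof -
    have "g (Z \<omega>) \<in> C" using ZK[OF that] gC by blast
    from b[OF this] show ?thesis by linarith
  qed
  have gZ: "(\<lambda>\<omega>. g (Z \<omega>)) \<in> borel_measurable M" by measurable
  obtain \<kappa>0 where \<kappa>0: "\<kappa>0 \<in> measurable N (prob_algebra borel)"
    and \<kappa>0_eq: "\<And>A B. A \<in> sets N \<Longrightarrow> B \<in> sets borel \<Longrightarrow>
       emeasure M (X -` A \<inter> (\<lambda>\<omega>. g (Z \<omega>)) -` B \<inter> space M) = (\<integral>\<^sup>+x\<in>A. emeasure (\<kappa>0 x) B \<partial>\<mu>)"
  proof (rule real_regular_conditional_distribution[OF X gZ])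
    show "- b \<le> g (Z \<omega>) \<and> g (Z \<omega>) \<le> b" if "\<omega> \<in> space M" for \<omega> by (rule gZ_bd[OF that])
  qed (rule that, assumption, simp add: \<mu>_def)
  define \<kappa> where "\<kappa> x = distr (\<kappa>0 x) L f'" for x
  have \<kappa>[measurable]: "\<kappa> \<in> measurable N (prob_algebra L)"
    unfolding \<kappa>_def using measurable_compose[OF \<kappa>0 measurable_distr_prob_space[OF f']] .
  have rect: "emeasure M (X -` A \<inter> Z -` B \<inter> space M) = (\<integral>\<^sup>+x\<in>A. emeasure (\<kappa> x) B \<partial>\<mu>)"
    if A[measurable]: "A \<in> sets N" and B[measurable]: "B \<in> sets L" for A B
  proof -
    have "f' (g (Z \<omega>)) = Z \<omega>" if "\<omega> \<in> space M" for \<omega>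
      using ZK[OF that] gC fg by (auto simp: f'_def)
    then have "X -` A \<inter> Z -` B \<inter> space M = X -` A \<inter> (\<lambda>\<omega>. g (Z \<omega>)) -` (f' -` B) \<inter> space M" by auto
    moreover have "f' -` B \<in> sets borel" using measurable_sets[OF f' B] by simp
    ultimately have "emeasure M (X -` A \<inter> Z -` B \<inter> space M) = (\<integral>\<^sup>+x\<in>A. emeasure (\<kappa>0 x) (f' -` B) \<partial>\<mu>)"
      using \<kappa>0_eq[OF A] by simp
    also have "\<dots> = (\<integral>\<^sup>+x\<in>A. emeasure (\<kappa> x) B \<partial>\<mu>)"
    proof (rule nn_integral_cong)
      fix x assume "x \<in> space \<mu>"
      then have "sets (\<kappa>0 x) = sets borel"
        using measurable_space[OF \<kappa>0, of x] by (simp add: space_prob_algebra \<mu>_def)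
      then have "emeasure (\<kappa> x) B = emeasure (\<kappa>0 x) (f' -` B)"
        unfolding \<kappa>_def using sets_eq_imp_space_eq[of "\<kappa>0 x" borel]
        by (subst emeasure_distr) (auto cong: measurable_cong_sets)
      then show "emeasure (\<kappa>0 x) (f' -` B) * indicator A x = emeasure (\<kappa> x) B * indicator A x" by simp
    qed
    finally show ?thesis .
  qed
  define m1 where "m1 = distr M (N \<Otimes>\<^sub>M L) (\<lambda>\<omega>. (X \<omega>, Z \<omega>))"
  define R where "R x = distr (\<kappa> x) (N \<Otimes>\<^sub>M L) (\<lambda>y. (x, y))" for x
  have R: "R \<in> measurable N (prob_algebra (N \<Otimes>\<^sub>M L))"
    unfolding R_def by (rule measurable_distr_prob_space2[OF \<kappa>]) simp
  have \<mu>_in: "\<mu> \<in> space (prob_algebra N)"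
    by (simp add: space_prob_algebra \<mu>_def prob_space_distr[OF X])
  have "m1 = \<mu> \<bind> R"
  proof (rule measure_eqI_generator_eq[OF Int_stable_pair_measure_generator[of N L], where A = "\<lambda>_. space N \<times> space L"])
    show "{a \<times> b |a b. a \<in> sets N \<and> b \<in> sets L} \<subseteq> Pow (space N \<times> space L)"
      by (rule pair_measure_closed)
    show "sets m1 = sigma_sets (space N \<times> space L) {a \<times> b |a b. a \<in> sets N \<and> b \<in> sets L}"
      by (simp add: m1_def sets_pair_measure)
    show "sets (\<mu> \<bind> R) = sigma_sets (space N \<times> space L) {a \<times> b |a b. a \<in> sets N \<and> b \<in> sets L}"
      using sets_bind'[OF \<mu>_in R] by (simp add: sets_pair_measure)
    interpret m1: prob_space m1 unfolding m1_def by (rule prob_space_distr) measurable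
    show "emeasure m1 (space N \<times> space L) \<noteq> \<infinity>" by simp
    show "range (\<lambda>_::nat. space N \<times> space L) \<subseteq> {a \<times> b |a b. a \<in> sets N \<and> b \<in> sets L}"
      using sets.top[of N] sets.top[of L] by blast
    fix S assume "S \<in> {a \<times> b |a b. a \<in> sets N \<and> b \<in> sets L}"
    then obtain A B where S: "S = A \<times> B" and [measurable]: "A \<in> sets N" "B \<in> sets L" by blast
    have "emeasure m1 S = emeasure M (X -` A \<inter> Z -` B \<inter> space M)"
      unfolding m1_def S by (subst emeasure_distr) (auto intro!: arg_cong[where f = "emeasure M"])
    also have "\<dots> = (\<integral>\<^sup>+x\<in>A. emeasure (\<kappa> x) B \<partial>\<mu>)" by (rule rect) auto
    also have "\<dots> = (\<integral>\<^sup>+x. emeasure (R x) S \<partial>\<mu>)"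
    proof (rule nn_integral_cong)
      fix x assume "x \<in> space \<mu>"
      then have x: "x \<in> space N" by (simp add: \<mu>_def)
      then have \<kappa>x: "sets (\<kappa> x) = sets L"
        using measurable_space[OF \<kappa>, of x] by (simp add: space_prob_algebra)
      note [measurable_cong] = \<kappa>x
      have "emeasure (R x) S = emeasure (\<kappa> x) ((\<lambda>y. (x, y)) -` S \<inter> space (\<kappa> x))"
        unfolding R_def using x by (subst emeasure_distr) (auto simp: S)
      also have "(\<lambda>y. (x, y)) -` S \<inter> space (\<kappa> x) = (if x \<in> A then B else {})"
        using sets.sets_into_space[of B L] sets_eq_imp_space_eq[OF \<kappa>x] by (auto simp: S)
      finally show "emeasure (\<kappa> x) B * indicator A x = emeasure (R x) S" by simp
    qed
    also have "\<dots> = emeasure (\<mu> \<bind> R) S"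
      using emeasure_bind_prob_algebra[OF \<mu>_in R, of S] by (simp add: S)
    finally show "emeasure m1 S = emeasure (\<mu> \<bind> R) S" .
  qed auto
  then show thesis using \<kappa> unfolding m1_def R_def L_def \<mu>_def by (intro that)
qed

section \<open>Duality bound and test functions\<close>

text \<open>The function type carries the product over all indices, so the coordinates outside
  \<open>I\<close> are first pinned to the singleton of \<open>undefined\<close>, after which
  Tychonoff applies.\<close>

lemma compact_PiE_fun:
  fixes X :: "'i \<Rightarrow> 'b::topological_space set"
  assumes "\<And>i. i \<in> I \<Longrightarrow> compact (X i)"
  shows "compact (\<Pi>\<^sub>E i\<in>I. X i)"
proof -
  define Y where "Y i = (if i \<in> I then X i else {undefined})" for i
  have "(\<Pi>\<^sub>E i\<in>I. X i) = (\<Pi>\<^sub>E i\<in>UNIV. Y i)"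
    by (auto simp: Y_def PiE_iff extensional_def split: if_splits)
  moreover have "compact (Y i)" for i using assms by (auto simp: Y_def)
  then have "compactin (product_topology (\<lambda>i. euclidean) UNIV) (\<Pi>\<^sub>E i\<in>UNIV. Y i)"
    by (subst compactin_PiE) auto
  ultimately show ?thesis by (simp add: euclidean_product_topology)
qed

text \<open>The last coordinate is eliminated by replacing its potential with the supremum \<open>V\<close> of the
  affine minorants supplied by the constraint; \<open>V\<close> is convex, so the convex order moves it
  to the preceding marginal.\<close>

lemma martingale_dual_bound:
  fixes X :: "nat \<Rightarrow> 'a::euclidean_space set" and \<mu> :: "nat \<Rightarrow> 'a measure"
    and h :: "nat \<Rightarrow> (nat \<Rightarrow> 'a) \<Rightarrow> 'a"
  assumes "n \<ge> 1"
    and "\<And>i. i \<in> {1..n} \<Longrightarrow> compact (X i)"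
    and "\<And>i. i \<in> {1..n} \<Longrightarrow> \<mu> i \<in> borel_probs (X i)"
    and "\<And>i. i \<in> {1..<n} \<Longrightarrow> convex_order (\<mu> i) (\<mu> (i+1))"
    and "\<And>i. i \<in> {1..n} \<Longrightarrow> continuous_on (X i) (\<phi> i)"
    and "\<And>i. i \<in> {1..<n} \<Longrightarrow> \<exists>B. \<forall>x\<in>(\<Pi>\<^sub>E j\<in>{1..i}. X j). norm (h i x) \<le> B"
    and "\<And>x. x \<in> (\<Pi>\<^sub>E j\<in>{1..n}. X j) \<Longrightarrow>
       s \<le> (\<Sum>i=1..n. \<phi> i (x i)) + (\<Sum>i\<in>{1..<n}. h i (restrict x {1..i}) \<bullet> (x (i+1) - x i))"
  shows "s \<le> (\<Sum>i=1..n. \<integral>z. \<phi> i z \<partial>\<mu> i)"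
  using assms
proof (induction n arbitrary: \<phi> rule: nat_induct_at_least)
  case base
  have 1: "compact (X 1)" "\<mu> 1 \<in> borel_probs (X 1)" "continuous_on (X 1) (\<phi> 1)" using base by auto
  interpret prob_space "\<mu> 1" using 1 by (simp add: borel_probs_iff)
  have "s \<le> \<phi> 1 z" if "z \<in> X 1" for z
    using base(6)[of "restrict (\<lambda>_. z) {1..1}"] that by (auto simp: PiE_iff extensional_def)
  then have "(\<integral>z. s \<partial>\<mu> 1) \<le> (\<integral>z. \<phi> 1 z \<partial>\<mu> 1)"
    using 1 by (intro integral_mono integrable_borel_probs[OF 1(2,1)]) (auto simp: space_borel_probs)
  then show ?case using prob_space by simp
next
  case (Suc n)
  have pr: "prob_space (\<mu> i)" if "i \<in> {1..Suc n}" for i using Suc.prems(2)[OF that] by (simp add: borel_probs_iff)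
  let ?K = "\<Pi>\<^sub>E j\<in>{1..n}. X j"
  obtain B where B: "\<And>x. x \<in> ?K \<Longrightarrow> norm (h n x) \<le> B" using Suc.prems(5)[of n] Suc.hyps by auto
  have Xne: "X i \<noteq> {}" if "i \<in> {1..Suc n}" for i using borel_probs_nonempty[OF Suc.prems(2)[OF that]] .
  then obtain z0 where z0: "z0 \<in> X (Suc n)" by fastforce
  have Kne: "?K \<noteq> {}" using Xne by (auto simp: PiE_eq_empty_iff)
  define Q where "Q x = s - (\<Sum>i=1..n. \<phi> i (x i)) - (\<Sum>i\<in>{1..<n}. h i (restrict x {1..i}) \<bullet> (x (i+1) - x i))" for x
  \<comment> \<open>For a fixed history \<open>x\<close> this is affine in \<open>z\<close> with
    slope \<open>- h n x\<close>; the hypothesis for \<open>n + 1\<close> coordinates says that it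
    minorises \<open>\<phi> (Suc n)\<close> on \<open>X (Suc n)\<close>.\<close>
  define R where "R x z = Q x - h n x \<bullet> (z - x n)" for x z
  have R_le: "R x z \<le> \<phi> (Suc n) z" if x: "x \<in> ?K" and z: "z \<in> X (Suc n)" for x z
  proof -
    define y where "y = x(Suc n := z)"
    have y: "y \<in> (\<Pi>\<^sub>E j\<in>{1..Suc n}. X j)"
      using x z by (auto simp: y_def PiE_iff extensional_def le_Suc_eq)
    have ry: "restrict y {1..i} = restrict x {1..i}" if "i \<le> n" for i
      using that by (auto simp: y_def restrict_def)
    have yi: "y i = x i" if "i \<le> n" for i using that by (simp add: y_def)
    have "(\<Sum>i=1..Suc n. \<phi> i (y i)) = (\<Sum>i=1..n. \<phi> i (x i)) + \<phi> (Suc n) z"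
      by (simp add: y_def)
    moreover have "(\<Sum>i\<in>{1..<Suc n}. h i (restrict y {1..i}) \<bullet> (y (i+1) - y i)) =
        (\<Sum>i\<in>{1..<n}. h i (restrict x {1..i}) \<bullet> (x (i+1) - x i)) + h n x \<bullet> (z - x n)"
    proof -
      have "{1..<Suc n} = insert n {1..<n}" using Suc.hyps by auto
      moreover have "restrict y {1..n} = x"
        using ry[of n] x by (simp add: PiE_restrict)
      moreover have "(\<Sum>i\<in>{1..<n}. h i (restrict y {1..i}) \<bullet> (y (i+1) - y i)) =
          (\<Sum>i\<in>{1..<n}. h i (restrict x {1..i}) \<bullet> (x (i+1) - x i))"
        by (intro sum.cong) (auto simp: ry yi simp del: One_nat_def)
      ultimately show ?thesis by (simp add: y_def)
    qed
    ultimately show ?thesis using Suc.prems(6)[OF y] unfolding R_def Q_def by linarith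
  qed
  \<comment> \<open>The convex order tests functions convex on the whole space, so \<open>V\<close>
    must be finite off \<open>X (Suc n)\<close> too, where \<open>R_le\<close> gives nothing. Moving
    from \<open>z\<close> to the point \<open>z0\<close> costs at most the bounded slope times the
    distance.\<close>
  have bdd: "bdd_above ((\<lambda>x. R x z) ` ?K)" for z
  proof (rule bdd_aboveI2[where M = "\<phi> (Suc n) z0 + B * norm (z0 - z)"])
    fix x assume x: "x \<in> ?K"
    have "R x z = R x z0 + h n x \<bullet> (z0 - z)" by (simp add: R_def inner_diff_right)
    also have "\<dots> \<le> \<phi> (Suc n) z0 + norm (h n x) * norm (z0 - z)"
      by (intro add_mono R_le x z0 norm_cauchy_schwarz)
    also have "\<dots> \<le> \<phi> (Suc n) z0 + B * norm (z0 - z)"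
      using B[OF x] by (intro add_left_mono mult_right_mono) auto
    finally show "R x z \<le> \<phi> (Suc n) z0 + B * norm (z0 - z)" .
  qed
  define V where "V z = (SUP x\<in>?K. R x z)" for z
  have R_le_V: "R x z \<le> V z" if "x \<in> ?K" for x z unfolding V_def by (rule cSUP_upper[OF that bdd])
  have V_conv: "convex_on UNIV V"
  proof (rule convex_onI)
    fix t :: real and u v :: 'a assume t: "0 < t" "t < 1"
    show "V ((1 - t) *\<^sub>R u + t *\<^sub>R v) \<le> (1 - t) * V u + t * V v"
      unfolding V_def[of "(1 - t) *\<^sub>R u + t *\<^sub>R v"]
    proof (rule cSUP_least[OF Kne])
      fix x assume x: "x \<in> ?K"
      have "R x ((1 - t) *\<^sub>R u + t *\<^sub>R v) = (1 - t) * R x u + t * R x v"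
        by (simp add: R_def inner_diff_right inner_add_right algebra_simps)
      also have "\<dots> \<le> (1 - t) * V u + t * V v"
        using t R_le_V[OF x] by (intro add_mono mult_left_mono) auto
      finally show "R x ((1 - t) *\<^sub>R u + t *\<^sub>R v) \<le> (1 - t) * V u + t * V v" .
    qed
  qed simp
  have V_cont: "continuous_on S V" for S
    using convex_on_continuous[OF open_UNIV V_conv] by (rule continuous_on_subset) simp
  have V_le: "V z \<le> \<phi> (Suc n) z" if "z \<in> X (Suc n)" for z
    unfolding V_def by (rule cSUP_least[OF Kne]) (rule R_le[OF _ that])
  \<comment> \<open>At \<open>z = x n\<close> the last increment vanishes and
    \<open>R x (x n) = Q x\<close>, so adding \<open>V\<close> to the potential at time
    \<open>n\<close> restores the hypothesis with one coordinate fewer.\<close>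
  define \<phi>' where "\<phi>' = \<phi>(n := \<lambda>z. \<phi> n z + V z)"
  have split: "(\<Sum>i=1..n. f i) = (\<Sum>i\<in>{1..<n}. f i) + f n" for f :: "nat \<Rightarrow> real"
    using Suc.hyps by (simp add: sum.last_plus add.commute)
  have "s \<le> (\<Sum>i=1..n. \<integral>z. \<phi>' i z \<partial>\<mu> i)"
  proof (rule Suc.IH)
    show "continuous_on (X i) (\<phi>' i)" if "i \<in> {1..n}" for i
      using Suc.prems(4)[of i] that by (auto simp: \<phi>'_def intro!: continuous_on_add V_cont)
    fix x assume x: "x \<in> ?K"
    have "R x (x n) = Q x" by (simp add: R_def)
    then have "Q x \<le> V (x n)" using R_le_V[OF x, of "x n"] by simp
    moreover have "(\<Sum>i=1..n. \<phi>' i (x i)) = (\<Sum>i=1..n. \<phi> i (x i)) + V (x n)"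
      unfolding split by (simp add: \<phi>'_def)
    ultimately show "s \<le> (\<Sum>i=1..n. \<phi>' i (x i)) + (\<Sum>i\<in>{1..<n}. h i (restrict x {1..i}) \<bullet> (x (i+1) - x i))"
      by (simp add: Q_def)
  qed (use Suc.prems in auto)
  also have "\<dots> = (\<Sum>i=1..n. \<integral>z. \<phi> i z \<partial>\<mu> i) + (\<integral>z. V z \<partial>\<mu> n)"
  proof -
    have n: "n \<in> {1..Suc n}" using Suc.hyps by simp
    have "(\<integral>z. \<phi> n z + V z \<partial>\<mu> n) = (\<integral>z. \<phi> n z \<partial>\<mu> n) + (\<integral>z. V z \<partial>\<mu> n)"
      using Suc.prems(1,2,4)[OF n]
      by (intro Bochner_Integration.integral_add integrable_borel_probs V_cont) auto
    then show ?thesis unfolding split by (simp add: \<phi>'_def)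
  qed
  also have "(\<integral>z. V z \<partial>\<mu> n) \<le> (\<integral>z. V z \<partial>\<mu> (Suc n))"
    using Suc.prems(3)[of n] Suc.hyps V_conv by (simp add: convex_order_def)
  also have "(\<integral>z. V z \<partial>\<mu> (Suc n)) \<le> (\<integral>z. \<phi> (Suc n) z \<partial>\<mu> (Suc n))"
  proof (rule integral_mono)
    have S: "Suc n \<in> {1..Suc n}" by simp
    note p = Suc.prems(1,2,4)[OF S]
    show "integrable (\<mu> (Suc n)) V" by (rule integrable_borel_probs[OF p(2,1) V_cont])
    show "integrable (\<mu> (Suc n)) (\<phi> (Suc n))" by (rule integrable_borel_probs[OF p(2,1,3)])
    show "V z \<le> \<phi> (Suc n) z" if "z \<in> space (\<mu> (Suc n))" for z
      using V_le that space_borel_probs[OF p(2)] by simp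
  qed
  finally show ?case by simp
qed

section \<open>Continuous functions that determine measures and densities\<close>

text \<open>For open \<open>U\<close> these rise to its indicator as \<open>k\<close> grows. The
  whole space is a separate case because \<open>infdist\<close> to the empty set is 0 by convention,
  which would give 0 instead of 1.\<close>

definition bump :: "'b::metric_space set \<Rightarrow> nat \<Rightarrow> 'b \<Rightarrow> real" where
  "bump U k x = (if U = UNIV then 1 else min 1 (real k * infdist x (- U)))"

lemma bump_continuous: "continuous_on S (bump U k)"
  by (cases "U = UNIV") (auto simp: bump_def[abs_def] intro!: continuous_intros)

lemma bump_measurable[measurable]: "bump U k \<in> borel_measurable borel"
  by (intro borel_measurable_continuous_onI bump_continuous)

lemma bump_bounds: "0 \<le> bump U k x" "bump U k x \<le> 1"
  by (auto simp: bump_def infdist_nonneg)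

lemma bump_tendsto_indicator:
  assumes "open U"
  shows "(\<lambda>k. bump U k x) \<longlonglongrightarrow> indicator U x"
proof (cases "x \<in> U \<and> U \<noteq> UNIV")
  case True
  then have "infdist x (- U) \<noteq> 0"
    using in_closed_iff_infdist_zero[of "- U" x] assms by (auto simp: closed_Compl)
  then have pos: "infdist x (- U) > 0" using infdist_nonneg[of x "- U"] by linarith
  obtain k0 :: nat where k0: "1 / infdist x (- U) < k0" using reals_Archimedean2 by blast
  have "bump U k x = 1" if "k \<ge> k0" for k
  proof -
    have "1 / infdist x (- U) \<le> k" using k0 that by linarith
    then have "1 \<le> real k * infdist x (- U)" using pos by (simp add: field_simps)
    then show ?thesis by (simp add: bump_def)
  qed
  then show ?thesis using True
    by (intro tendsto_eventually) (auto simp: eventually_sequentially)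
next
  case False
  then consider "U = UNIV" | "x \<notin> U" "U \<noteq> UNIV" by blast
  then show ?thesis
  proof cases
    case 2
    then have "infdist x (- U) = 0" by (intro infdist_zero) simp
    then show ?thesis using 2 by (simp add: bump_def)
  qed (simp add: bump_def)
qed

text \<open>Closing a countable basis under finite intersections keeps it countable and makes it a
  generator to which uniqueness of measures applies; the empty intersection contributes
  \<open>UNIV\<close>.\<close>

lemma countable_Int_stable_basis:
  obtains \<B> :: "'b::second_countable_topology set set" where
    "countable \<B>" "Int_stable \<B>" "UNIV \<in> \<B>" "\<And>U. U \<in> \<B> \<Longrightarrow> open U"
    "sets borel = sigma_sets UNIV \<B>"
proof -
  obtain B :: "'b set set" where B: "countable B" "topological_basis B" using ex_countable_basis by blast
  define \<B> where "\<B> = Inter ` {F. finite F \<and> F \<subseteq> B}"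
  have op: "open U" if "U \<in> \<B>" for U
    using that topological_basis_open[OF B(2)] by (auto simp: \<B>_def intro!: open_Inter)
  show thesis
  proof
    show "countable \<B>" unfolding \<B>_def
      using countable_Collect_finite_subset[OF B(1)] by (simp add: conj_commute)
    show "Int_stable \<B>"
    proof (rule Int_stableI)
      fix U V assume "U \<in> \<B>" "V \<in> \<B>"
      then obtain F G where "U = \<Inter>F" "V = \<Inter>G" "finite F" "finite G" "F \<subseteq> B" "G \<subseteq> B"
        by (auto simp: \<B>_def)
      then show "U \<inter> V \<in> \<B>" unfolding \<B>_def
        by (intro image_eqI[of _ _ "F \<union> G"]) auto
    qed
    show "UNIV \<in> \<B>" unfolding \<B>_def by (intro image_eqI[of _ _ "{}"]) auto
    show "open U" if "U \<in> \<B>" for U using op[OF that] .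
    have "B \<subseteq> \<B>"
    proof
      fix U assume "U \<in> B"
      then show "U \<in> \<B>" unfolding \<B>_def by (intro image_eqI[of _ _ "{U}"]) auto
    qed
    then have "sigma_sets UNIV B \<subseteq> sigma_sets UNIV \<B>" by (rule sigma_sets_mono')
    moreover have "sets borel = sigma_sets UNIV B"
      by (subst borel_eq_countable_basis[OF B]) simp
    moreover have "sigma_sets UNIV \<B> \<subseteq> sets borel"
      using sets.sigma_sets_subset[of \<B> borel] op by (simp add: subset_eq)
    ultimately show "sets borel = sigma_sets UNIV \<B>" by blast
  qed
qed

lemma borel_probs_eqI:
  fixes \<gamma> \<gamma>' :: "'b::metric_space measure"
  assumes g: "\<gamma> \<in> borel_probs K" "\<gamma>' \<in> borel_probs K"
    and B: "Int_stable \<B>" "UNIV \<in> \<B>" "\<And>U. U \<in> \<B> \<Longrightarrow> open U" "sets borel = sigma_sets UNIV \<B>"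
    and eq: "\<And>U k. U \<in> \<B> \<Longrightarrow> (\<integral>x. bump U k x \<partial>\<gamma>) = (\<integral>x. bump U k x \<partial>\<gamma>')"
  shows "\<gamma> = \<gamma>'"
proof -
  have id[measurable]: "(\<lambda>x. x) \<in> borel_measurable \<rho>" if "\<rho> \<in> borel_probs K" for \<rho> :: "'b measure"
    using that measurable_restrict_space1[OF measurable_ident, of borel K]
    by (simp add: borel_probs_iff id_def cong: measurable_cong_sets)
  have lim: "(\<lambda>k. \<integral>x. bump U k x \<partial>\<rho>) \<longlonglongrightarrow> measure \<rho> (U \<inter> K)"
    if \<rho>: "\<rho> \<in> borel_probs K" and U: "open U" for \<rho> :: "'b measure" and U
  proof -
    interpret prob_space \<rho> using \<rho> by (simp add: borel_probs_iff)
    note [measurable] = id[OF \<rho>]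
    have [measurable]: "U \<in> sets borel" using U by simp
    have "(\<lambda>k. \<integral>x. bump U k x \<partial>\<rho>) \<longlonglongrightarrow> (\<integral>x. indicator U x \<partial>\<rho>)"
    proof (rule integral_dominated_convergence[where w = "\<lambda>_. 1"])
      show "AE x in \<rho>. (\<lambda>k. bump U k x) \<longlonglongrightarrow> indicator U x"
        by (intro AE_I2 bump_tendsto_indicator U)
      show "AE x in \<rho>. norm (bump U k x) \<le> 1" for k by (intro AE_I2) (simp add: bump_bounds)
    qed (auto intro!: measurable_compose[OF id[OF \<rho>]] bump_measurable)
    then show ?thesis by (simp add: space_borel_probs[OF \<rho>])
  qed
  have eqU: "measure \<gamma> (U \<inter> K) = measure \<gamma>' (U \<inter> K)" if "U \<in> \<B>" for U
    using lim[OF g(1) B(3)[OF that]] lim[OF g(2) B(3)[OF that]] eq[OF that] LIMSEQ_unique by simp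
  have em: "emeasure (distr \<rho> borel (\<lambda>x. x)) U = emeasure \<rho> (U \<inter> K)"
    if "\<rho> \<in> borel_probs K" "U \<in> sets borel" for \<rho> :: "'b measure" and U
    using that id[OF that(1)] by (simp add: emeasure_distr space_borel_probs)
  \<comment> \<open>The generator lives on the whole space and the measures on traces in
    \<open>K\<close>, so they are compared after pushing forward along the inclusion.\<close>
  have "distr \<gamma> borel (\<lambda>x. x) = distr \<gamma>' borel (\<lambda>x. x)"
  proof (rule measure_eqI_generator_eq[OF B(1), where \<Omega> = UNIV and A = "\<lambda>_. UNIV"])
    interpret g: prob_space \<gamma> using g by (simp add: borel_probs_iff)
    interpret g': prob_space \<gamma>' using g by (simp add: borel_probs_iff)
    show "emeasure (distr \<gamma> borel (\<lambda>x. x)) U = emeasure (distr \<gamma>' borel (\<lambda>x. x)) U" if "U \<in> \<B>" for U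
      using B(3)[OF that] eqU[OF that] by (simp add: em g g.emeasure_eq_measure g'.emeasure_eq_measure)
    show "emeasure (distr \<gamma> borel (\<lambda>x. x)) UNIV \<noteq> \<infinity>" by (simp add: em g)
  qed (use B in auto)
  show ?thesis
  proof (rule measure_eqI)
    show "sets \<gamma> = sets \<gamma>'" using g by (simp add: borel_probs_iff)
    fix A assume "A \<in> sets \<gamma>"
    then obtain S where S: "S \<in> sets borel" "A = S \<inter> K"
      using g(1) by (auto simp: borel_probs_iff sets_restrict_space)
    then show "emeasure \<gamma> A = emeasure \<gamma>' A"
      using em[OF g(1) S(1)] em[OF g(2) S(1)] \<open>distr \<gamma> borel _ = _\<close> by simp
  qed
qed

text \<open>As \<open>m\<close> may change sign, its integrals over sets form no measure, so
  uniqueness on a generator is replaced by a Dynkin class argument: the sets over which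
  \<open>m\<close> integrates to 0 contain the generator and are closed under complements and
  countable disjoint unions.\<close>

lemma AE_zero_if_bump_integrals_zero:
  fixes m :: "'b::metric_space \<Rightarrow> real"
  assumes fin: "finite_measure N" and N: "sets N = sets (restrict_space borel K)"
    and m: "integrable N m"
    and B: "Int_stable \<B>" "UNIV \<in> \<B>" "\<And>U. U \<in> \<B> \<Longrightarrow> open U" "sets borel = sigma_sets UNIV \<B>"
    and eq: "\<And>U k. U \<in> \<B> \<Longrightarrow> (\<integral>x. bump U k x * m x \<partial>N) = 0"
  shows "AE x in N. m x = 0"
proof -
  interpret finite_measure N by (rule fin)
  have id[measurable]: "(\<lambda>x. x) \<in> borel_measurable N"
    using measurable_restrict_space1[OF measurable_ident, of borel K] N by (simp add: id_def cong: measurable_cong_sets)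
  have [measurable]: "m \<in> borel_measurable N" using m by simp
  have bm[measurable]: "(\<lambda>x. bump U k x) \<in> borel_measurable N" for U k
    by (rule measurable_compose[OF id bump_measurable])
  have ind[measurable]: "(\<lambda>x. indicat_real S x) \<in> borel_measurable N" if "S \<in> sets borel" for S
    using that by measurable
  have int_ind: "integrable N (\<lambda>x. indicat_real S x * m x)" if "S \<in> sets borel" for S
    using that by (intro Bochner_Integration.integrable_bound[OF m]) (auto simp: indicator_def)
  have on_basis: "(\<integral>x. indicat_real U x * m x \<partial>N) = 0" if U: "U \<in> \<B>" for U
  proof -
    have [measurable]: "U \<in> sets borel" using B(3)[OF U] by simp
    have "(\<lambda>k. \<integral>x. bump U k x * m x \<partial>N) \<longlonglongrightarrow> (\<integral>x. indicator U x * m x \<partial>N)"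
    proof (rule integral_dominated_convergence[where w = "\<lambda>x. norm (m x)"])
      show "AE x in N. (\<lambda>k. bump U k x * m x) \<longlonglongrightarrow> indicator U x * m x"
        by (intro AE_I2 tendsto_mult_right bump_tendsto_indicator B(3)[OF U])
      show "AE x in N. norm (bump U k x * m x) \<le> norm (m x)" for k
        by (intro AE_I2) (simp add: abs_mult bump_bounds mult_left_le_one_le)
    qed (use m in auto)
    then show ?thesis using eq[OF U] by (simp add: LIMSEQ_const_iff)
  qed
  have all: "(\<integral>x. indicat_real S x * m x \<partial>N) = 0" if "S \<in> sets borel" for S
  proof -
    have "\<B> \<subseteq> Pow UNIV" by simp
    from B(1) this that[unfolded B(4)] show ?thesis
  proof (induction rule: sigma_sets_induct_disjoint)
    case (basic A)
    then show ?case by (rule on_basis)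
  next
    case empty
    then show ?case by simp
  next
    case (compl A)
    then have A: "A \<in> sets borel" using B(4) by simp
    have "(\<integral>x. indicat_real (UNIV - A) x * m x \<partial>N) = (\<integral>x. indicat_real UNIV x * m x - indicat_real A x * m x \<partial>N)"
      by (intro Bochner_Integration.integral_cong) (auto simp: indicator_def)
    also have "\<dots> = (\<integral>x. indicat_real UNIV x * m x \<partial>N) - (\<integral>x. indicat_real A x * m x \<partial>N)"
      using A by (intro Bochner_Integration.integral_diff int_ind) auto
    finally show ?case using on_basis[OF B(2)] compl by simp
  next
    case (union A)
    then have A: "A i \<in> sets borel" for i using B(4) by auto
    have "(\<integral>x. indicat_real (\<Union>i<n. A i) x * m x \<partial>N) = 0" for n
    proof -
      have "disjoint_family_on A {..<n}" using union(1) by (rule disjoint_family_on_mono[rotated]) simp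
      then have "(\<integral>x. indicat_real (\<Union>i<n. A i) x * m x \<partial>N) = (\<integral>x. (\<Sum>i<n. indicat_real (A i) x * m x) \<partial>N)"
        by (simp add: indicator_UN_disjoint sum_distrib_right)
      also have "\<dots> = 0" using union A by (subst Bochner_Integration.integral_sum) (auto intro: int_ind)
      finally show ?thesis .
    qed
    moreover have "(\<lambda>n. \<integral>x. indicat_real (\<Union>i<n. A i) x * m x \<partial>N) \<longlonglongrightarrow> (\<integral>x. indicat_real (\<Union>i. A i) x * m x \<partial>N)"
    proof (rule integral_dominated_convergence[where w = "\<lambda>x. norm (m x)"])
      show "AE x in N. (\<lambda>n. indicat_real (\<Union>i<n. A i) x * m x) \<longlonglongrightarrow> indicat_real (\<Union>i. A i) x * m x"
        by (intro AE_I2 tendsto_mult_right LIMSEQ_indicator_UN)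
      show "AE x in N. norm (indicat_real (\<Union>i<n. A i) x * m x) \<le> norm (m x)" for n
        by (intro AE_I2) (simp add: indicator_def)
      show "(\<lambda>x. indicat_real (\<Union>i. A i) x * m x) \<in> borel_measurable N"
        using A by (intro borel_measurable_times ind sets.countable_UN) auto
      show "(\<lambda>x. indicat_real (\<Union>i<n. A i) x * m x) \<in> borel_measurable N" for n
        using A by (intro borel_measurable_times ind sets.finite_UN) auto
    qed (use m in auto)
    ultimately show ?case by (simp add: LIMSEQ_const_iff)
  qed
  qed
  show ?thesis
  proof (rule density_unique_real)
    show "integrable N (\<lambda>_. 0::real)" by simp
    fix A assume "A \<in> sets N"
    then obtain S where S: "S \<in> sets borel" "A = S \<inter> K" using N by (auto simp: sets_restrict_space)
    have "space N = K" using sets_eq_imp_space_eq[OF N] by (simp add: space_restrict_space)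
    then have "set_lebesgue_integral N A m = (\<integral>x. indicat_real S x * m x \<partial>N)"
      unfolding set_lebesgue_integral_def S(2)
      by (intro Bochner_Integration.integral_cong) (auto simp: indicator_def)
    then show "set_lebesgue_integral N A m = set_lebesgue_integral N A (\<lambda>_. 0)"
      using all[OF S(1)] by (simp add: set_lebesgue_integral_def)
  qed (use m in auto)
qed

lemma prob_algebra_cong_sets: "sets M = sets N \<Longrightarrow> prob_algebra M = prob_algebra N"
  unfolding prob_algebra_def by (simp cong: subprob_algebra_cong)

section \<open>Moment characterisation of martingale couplings\<close>

locale compact_marginals =
  fixes n :: nat and X :: "nat \<Rightarrow> 'a::euclidean_space set" and \<mu> :: "nat \<Rightarrow> 'a measure"
  assumes n_pos: "n \<ge> 1"
    and compact_X: "\<And>i. i \<in> {1..n} \<Longrightarrow> compact (X i)"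
    and \<mu>_probs: "\<And>i. i \<in> {1..n} \<Longrightarrow> \<mu> i \<in> borel_probs (X i)"
begin

abbreviation K :: "(nat \<Rightarrow> 'a) set" where "K \<equiv> \<Pi>\<^sub>E i\<in>{1..n}. X i"

lemma compact_K: "compact K" by (intro compact_PiE_fun compact_X)

lemma K_nonempty: "K \<noteq> {}"
  using borel_probs_nonempty[OF \<mu>_probs] by (auto simp: PiE_eq_empty_iff)

lemma sets_probs: "\<pi> \<in> borel_probs K \<Longrightarrow> sets \<pi> = sets (prod_space {1..n} X)"
  by (simp add: borel_probs_iff sets_prod_space_eq_borel)

lemma bounded_X: obtains C where "C \<ge> 0" "\<And>i z. i \<in> {1..n} \<Longrightarrow> z \<in> X i \<Longrightarrow> norm z \<le> C"
proof -
  have *: "compact (\<Union>i\<in>{1..n}. X i)" by (intro compact_UN compact_X) auto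
  obtain C where C: "\<forall>z\<in>(\<Union>i\<in>{1..n}. X i). norm z \<le> C"
    using compact_imp_bounded[OF *] unfolding bounded_iff by blast
  show thesis
  proof
    show "0 \<le> \<bar>C\<bar>" by simp
    show "norm z \<le> \<bar>C\<bar>" if "i \<in> {1..n}" "z \<in> X i" for i z
    proof -
      have "norm z \<le> C" using C that by blast
      then show ?thesis by simp
    qed
  qed
qed

lemma coordinate_measurable:
  assumes "i \<in> I"
  shows "(\<lambda>x. x i) \<in> borel_measurable (prod_space I X)"
proof -
  have "(\<lambda>x. x i) \<in> measurable (prod_space I X) (restrict_space borel (X i))"
    unfolding prod_space_def using assms by (rule measurable_component_singleton)
  then show ?thesis by (rule measurable_restrict_space2_iff[THEN iffD1, THEN conjunct1])
qed

lemma restrict_measurable: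
  assumes "\<pi> \<in> borel_probs K" "I \<subseteq> {1..n}"
  shows "(\<lambda>x. restrict x I) \<in> measurable \<pi> (prod_space I X)"
proof -
  have "(\<lambda>x. restrict x I) \<in> measurable (prod_space {1..n} X) (prod_space I X)"
    unfolding prod_space_def by (rule measurable_restrict_subset[OF assms(2)])
  then show ?thesis using sets_probs[OF assms(1)] by (simp cong: measurable_cong_sets)
qed

lemma prob_space_marginal:
  assumes "\<pi> \<in> borel_probs K" "I \<subseteq> {1..n}"
  shows "prob_space (marginal I X \<pi>)" "sets (marginal I X \<pi>) = sets (prod_space I X)"
proof -
  interpret prob_space \<pi> using assms(1) by (simp add: borel_probs_iff)
  show "prob_space (marginal I X \<pi>)"
    unfolding marginal_def by (rule prob_space_distr[OF restrict_measurable[OF assms]])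
qed (simp add: marginal_def)

text \<open>The past and the future block are both points of the full function type, so the future
  block ranges over a compact subset of a Polish space and
  \<open>regular_conditional_distribution\<close> applies to the pair of restrictions.\<close>

lemma disintegration_exists:
  assumes \<pi>: "\<pi> \<in> borel_probs K" and i: "i \<in> {1..<n}"
  obtains \<kappa> where "is_disintegration n i X \<pi> \<kappa>"
proof -
  interpret prob_space \<pi> using \<pi> by (simp add: borel_probs_iff)
  define N L P where "N = prod_space {1..i} X" and "L = prod_space {i+1..n} X" and "P = prod_space {1..n} X"
  \<comment> \<open>\<open>L\<close> is the product form used in the definition of a disintegration,
    \<open>L'\<close> the Borel form that the conditioning theorem expects; they have the same
    measurable sets.\<close>
  define L' where "L' = restrict_space borel (\<Pi>\<^sub>E j\<in>{i+1..n}. X j)"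
  have setsL: "sets L = sets L'" by (simp add: L_def L'_def sets_prod_space_eq_borel)
  have rI: "(\<lambda>x. restrict x {1..i}) \<in> measurable \<pi> N"
    unfolding N_def by (rule restrict_measurable[OF \<pi>]) (use i in auto)
  have rJ: "(\<lambda>x. restrict x {i+1..n}) \<in> measurable \<pi> L"
    unfolding L_def by (rule restrict_measurable[OF \<pi>]) auto
  then have rJ': "(\<lambda>x. restrict x {i+1..n}) \<in> measurable \<pi> L'" using setsL by (simp cong: measurable_cong_sets)
  have cJ: "compact (\<Pi>\<^sub>E j\<in>{i+1..n}. X j)" by (intro compact_PiE_fun compact_X) auto
  obtain \<kappa> where \<kappa>: "\<kappa> \<in> measurable N (prob_algebra L')"
    and eq: "distr \<pi> (N \<Otimes>\<^sub>M L') (\<lambda>x. (restrict x {1..i}, restrict x {i+1..n})) =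
       distr \<pi> N (\<lambda>x. restrict x {1..i}) \<bind> (\<lambda>x. distr (\<kappa> x) (N \<Otimes>\<^sub>M L') (\<lambda>y. (x, y)))"
    unfolding L'_def by (rule regular_conditional_distribution[OF rI rJ'[unfolded L'_def] cJ])
  have un: "{1..i} \<union> {i+1..n} = {1..n}" using i by auto
  have "merge {1..i} {i+1..n} \<in> measurable (N \<Otimes>\<^sub>M L) P"
    unfolding N_def L_def P_def prod_space_def un[symmetric] by (rule measurable_merge)
  then have mg: "merge {1..i} {i+1..n} \<in> measurable (N \<Otimes>\<^sub>M L') P"
    using setsL by (simp cong: measurable_cong_sets)
  have R: "(\<lambda>x. distr (\<kappa> x) (N \<Otimes>\<^sub>M L') (\<lambda>y. (x, y))) \<in> measurable N (prob_algebra (N \<Otimes>\<^sub>M L'))"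
    by (rule measurable_distr_prob_space2[OF \<kappa>]) simp
  \<comment> \<open>Cutting and regluing returns \<open>x\<close> itself because points of
    \<open>K\<close> are \<open>undefined\<close> outside \<open>{1..n}\<close>.\<close>
  have mid: "merge {1..i} {i+1..n} (restrict x {1..i}, restrict x {i+1..n}) = x" if "x \<in> space \<pi>" for x
    using that space_borel_probs[OF \<pi>] un by (auto simp: merge_def PiE_iff extensional_def fun_eq_iff)
  have "\<pi> = distr \<pi> P (\<lambda>x. x)" using sets_probs[OF \<pi>] by (simp add: P_def distr_id2)
  also have "\<dots> = distr \<pi> P (\<lambda>x. merge {1..i} {i+1..n} (restrict x {1..i}, restrict x {i+1..n}))"
    by (rule distr_cong[OF refl refl mid[symmetric]])
  also have "\<dots> = distr (distr \<pi> (N \<Otimes>\<^sub>M L') (\<lambda>x. (restrict x {1..i}, restrict x {i+1..n}))) P (merge {1..i} {i+1..n})"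
    using rI rJ' by (subst distr_distr[OF mg]) (auto simp: comp_def)
  also have "\<dots> = distr \<pi> N (\<lambda>x. restrict x {1..i}) \<bind>
      (\<lambda>x. distr (distr (\<kappa> x) (N \<Otimes>\<^sub>M L') (\<lambda>y. (x, y))) P (merge {1..i} {i+1..n}))"
    unfolding eq
  proof (rule distr_bind[OF _ _ mg])
    show "(\<lambda>x. distr (\<kappa> x) (N \<Otimes>\<^sub>M L') (\<lambda>y. (x, y))) \<in> measurable (distr \<pi> N (\<lambda>x. restrict x {1..i})) (subprob_algebra (N \<Otimes>\<^sub>M L'))"
      using measurable_prob_algebraD[OF R] by simp
    show "space (distr \<pi> N (\<lambda>x. restrict x {1..i})) \<noteq> {}"
      using measurable_space[OF rI] not_empty by fastforce
  qed
  also have "\<dots> = marginal {1..i} X \<pi> \<bind> (\<lambda>x. distr (\<kappa> x) P (\<lambda>y. merge {1..i} {i+1..n} (x, y)))"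
    unfolding marginal_def N_def[symmetric]
  proof (rule bind_cong[OF refl])
    fix x assume "x \<in> space (distr \<pi> N (\<lambda>x. restrict x {1..i}))"
    then have x: "x \<in> space N" by simp
    then have "sets (\<kappa> x) = sets L'" using measurable_space[OF \<kappa> x] by (simp add: space_prob_algebra)
    then have "(\<lambda>y. (x, y)) \<in> measurable (\<kappa> x) (N \<Otimes>\<^sub>M L')" using x by (simp cong: measurable_cong_sets)
    then show "distr (distr (\<kappa> x) (N \<Otimes>\<^sub>M L') (\<lambda>y. (x, y))) P (merge {1..i} {i+1..n}) =
        distr (\<kappa> x) P (\<lambda>y. merge {1..i} {i+1..n} (x, y))"
      by (subst distr_distr[OF mg]) (auto simp: comp_def)
  qed
  finally have "is_disintegration n i X \<pi> \<kappa>"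
    unfolding is_disintegration_def P_def using \<kappa> prob_algebra_cong_sets[OF setsL] by (simp add: N_def L_def)
  then show thesis by (rule that)
qed

lemma disintegration_integral:
  fixes \<Phi> :: "(nat \<Rightarrow> 'a) \<Rightarrow> real"
  assumes \<pi>: "\<pi> \<in> borel_probs K" and i: "i \<in> {1..<n}" and dis: "is_disintegration n i X \<pi> \<kappa>"
    and \<Phi>: "\<Phi> \<in> borel_measurable (prod_space {1..n} X)" and bd: "\<And>x. x \<in> K \<Longrightarrow> \<bar>\<Phi> x\<bar> \<le> C"
  shows "(\<integral>x. \<Phi> x \<partial>\<pi>) = (\<integral>x. (\<integral>y. \<Phi> (merge {1..i} {i+1..n} (x, y)) \<partial>\<kappa> x) \<partial>marginal {1..i} X \<pi>)"
proof -
  define N L P where "N = prod_space {1..i} X" and "L = prod_space {i+1..n} X" and "P = prod_space {1..n} X"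
  define m where "m = marginal {1..i} X \<pi>"
  have sub: "{1..i} \<subseteq> {1..n}" using i by auto
  interpret m: prob_space m unfolding m_def by (rule prob_space_marginal[OF \<pi> sub])
  have setsm: "sets m = sets N" unfolding m_def N_def by (rule prob_space_marginal[OF \<pi> sub])
  have un: "{1..i} \<union> {i+1..n} = {1..n}" using i by auto
  have mg: "merge {1..i} {i+1..n} \<in> measurable (N \<Otimes>\<^sub>M L) P"
    unfolding N_def L_def P_def prod_space_def un[symmetric] by (rule measurable_merge)
  have \<kappa>: "\<kappa> \<in> measurable N (prob_algebra L)" using dis by (simp add: is_disintegration_def N_def L_def)
  define R where "R x = distr (\<kappa> x) P (\<lambda>y. merge {1..i} {i+1..n} (x, y))" for x
  have R: "R \<in> measurable N (prob_algebra P)"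
    unfolding R_def by (rule measurable_distr_prob_space2[OF \<kappa>]) (use mg in simp)
  have Rm: "R \<in> measurable m (prob_algebra P)" using R setsm by (simp cong: measurable_cong_sets)
  have "\<pi> = m \<bind> R" using dis by (simp add: is_disintegration_def m_def R_def[abs_def] P_def)
  then have "(\<integral>x. \<Phi> x \<partial>\<pi>) = (\<integral>x. \<Phi> x \<partial>(m \<bind> R))" by simp
  also have "\<dots> = (\<integral>x. (\<integral>z. \<Phi> z \<partial>R x) \<partial>m)"
  proof (rule integral_bind[where K = P and B = C and B' = 1])
    show "\<Phi> \<in> borel_measurable P" using \<Phi> by (simp add: P_def)
    show "\<bar>\<Phi> x\<bar> \<le> C" if "x \<in> space P" for x using that bd by (simp add: P_def space_prod_space)
    show "R \<in> measurable m (subprob_algebra P)" by (rule measurable_prob_algebraD[OF Rm])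
    show "finite_measure m" by unfold_locales
    show "AE x in m. emeasure (R x) (space (R x)) \<le> ennreal 1"
    proof (rule AE_I2)
      fix x assume "x \<in> space m"
      then have "prob_space (R x)" using measurable_space[OF Rm] by (simp add: space_prob_algebra)
      then show "emeasure (R x) (space (R x)) \<le> ennreal 1" by (simp add: prob_space.emeasure_space_1)
    qed
  qed
  also have "\<dots> = (\<integral>x. (\<integral>y. \<Phi> (merge {1..i} {i+1..n} (x, y)) \<partial>\<kappa> x) \<partial>m)"
  proof (rule Bochner_Integration.integral_cong[OF refl])
    fix x assume "x \<in> space m"
    then have x: "x \<in> space N" using sets_eq_imp_space_eq[OF setsm] by simp
    have "sets (\<kappa> x) = sets L" using measurable_space[OF \<kappa> x] by (simp add: space_prob_algebra)
    then have "(\<lambda>y. merge {1..i} {i+1..n} (x, y)) \<in> measurable (\<kappa> x) P"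
      using measurable_compose[OF measurable_Pair1'[OF x] mg] by (simp cong: measurable_cong_sets)
    then show "(\<integral>z. \<Phi> z \<partial>R x) = (\<integral>y. \<Phi> (merge {1..i} {i+1..n} (x, y)) \<partial>\<kappa> x)"
      unfolding R_def using \<Phi> by (intro integral_distr) (simp_all add: P_def)
  qed
  finally show ?thesis by (simp add: m_def)
qed

text \<open>Tower property: a factor that depends on the past leaves the inner integral, and only
  the conditional mean of the increment remains. The left side involves \<open>\<pi>\<close> alone,
  which is how the kernel disappears from the martingale constraint.\<close>

lemma increment_integral:
  assumes \<pi>: "\<pi> \<in> borel_probs K" and i: "i \<in> {1..<n}" and dis: "is_disintegration n i X \<pi> \<kappa>"
    and g: "g \<in> borel_measurable (prod_space {1..i} X)" and bd: "\<And>x. \<bar>g x\<bar> \<le> 1"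
  shows "(\<integral>x. g (restrict x {1..i}) * ((x (i+1) - x i) \<bullet> b) \<partial>\<pi>) =
    (\<integral>x. g x * (((\<integral>y. y (i+1) \<partial>\<kappa> x) - x i) \<bullet> b) \<partial>marginal {1..i} X \<pi>)"
proof -
  define N L P where "N = prod_space {1..i} X" and "L = prod_space {i+1..n} X" and "P = prod_space {1..n} X"
  obtain C where C: "C \<ge> 0" "\<And>j z. j \<in> {1..n} \<Longrightarrow> z \<in> X j \<Longrightarrow> norm z \<le> C" using bounded_X by blast
  define \<Phi> where "\<Phi> x = g (restrict x {1..i}) * ((x (i+1) - x i) \<bullet> b)" for x
  have rs: "(\<lambda>x. restrict x {1..i}) \<in> measurable P N"
    unfolding P_def N_def prod_space_def by (rule measurable_restrict_subset) (use i in auto)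
  have [measurable]: "(\<lambda>x. x i) \<in> borel_measurable P" "(\<lambda>x. x (i+1)) \<in> borel_measurable P"
    unfolding P_def by (rule coordinate_measurable, use i in simp)+
  have "(\<lambda>x. g (restrict x {1..i})) \<in> borel_measurable P"
    using measurable_compose[OF rs] g by (simp add: N_def)
  then have \<Phi>_meas: "\<Phi> \<in> borel_measurable P" unfolding \<Phi>_def by measurable
  have \<Phi>_bd: "\<bar>\<Phi> x\<bar> \<le> 1 * ((C + C) * norm b)" if x: "x \<in> K" for x
  proof -
    have "norm (x (i+1) - x i) \<le> C + C"
    proof -
      have "x (i+1) \<in> X (i+1)" "x i \<in> X i" using x i by (auto simp: PiE_iff)
      then have "norm (x (i+1)) \<le> C" "norm (x i) \<le> C"
        using C(2)[of "i+1" "x (i+1)"] C(2)[of i "x i"] i by auto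
      then show ?thesis using norm_triangle_ineq4[of "x (i+1)" "x i"] by linarith
    qed
    then have "norm (x (i+1) - x i) * norm b \<le> (C + C) * norm b"
      by (rule mult_right_mono) simp
    then have "\<bar>(x (i+1) - x i) \<bullet> b\<bar> \<le> (C + C) * norm b"
      using Cauchy_Schwarz_ineq2[of "x (i+1) - x i" b] by linarith
    then show ?thesis unfolding \<Phi>_def abs_mult using bd by (intro mult_mono) auto
  qed
  have sub: "{1..i} \<subseteq> {1..n}" using i by auto
  have spm: "space (marginal {1..i} X \<pi>) = space N"
    using sets_eq_imp_space_eq[OF prob_space_marginal(2)[OF \<pi> sub]] by (simp add: N_def)
  have \<kappa>: "\<kappa> \<in> measurable N (prob_algebra L)" using dis by (simp add: is_disintegration_def N_def L_def)
  have inner: "(\<integral>y. \<Phi> (merge {1..i} {i+1..n} (x, y)) \<partial>\<kappa> x) = g x * (((\<integral>y. y (i+1) \<partial>\<kappa> x) - x i) \<bullet> b)"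
    if x: "x \<in> space N" for x
  proof -
    have \<kappa>x: "sets (\<kappa> x) = sets L" "prob_space (\<kappa> x)"
      using measurable_space[OF \<kappa> x] by (auto simp: space_prob_algebra)
    interpret \<kappa>x: prob_space "\<kappa> x" by fact
    have sp: "space (\<kappa> x) = (\<Pi>\<^sub>E j\<in>{i+1..n}. X j)"
      using sets_eq_imp_space_eq[OF \<kappa>x(1)] by (simp add: L_def space_prod_space)
    have xe: "x \<in> extensional {1..i}" using x by (simp add: N_def space_prod_space PiE_iff)
    have int: "integrable (\<kappa> x) (\<lambda>y. y (i+1))"
    proof (rule \<kappa>x.integrable_const_bound[where B = C])
      show "AE y in \<kappa> x. norm (y (i+1)) \<le> C"
        using i by (intro AE_I2 C(2)[of "i+1"]) (auto simp: sp PiE_iff)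
      show "(\<lambda>y. y (i+1)) \<in> borel_measurable (\<kappa> x)"
        using coordinate_measurable[of "i+1" "{i+1..n}"] i \<kappa>x(1) by (simp add: L_def cong: measurable_cong_sets)
    qed
    have "\<Phi> (merge {1..i} {i+1..n} (x, y)) = g x * (y (i+1) \<bullet> b - x i \<bullet> b)" for y
    proof -
      have "restrict (merge {1..i} {i+1..n} (x, y)) {1..i} = x"
        using extensional_restrict[OF xe] by simp
      moreover have "merge {1..i} {i+1..n} (x, y) (i+1) = y (i+1)" "merge {1..i} {i+1..n} (x, y) i = x i"
        using i by (auto simp: merge_def)
      ultimately show ?thesis by (simp add: \<Phi>_def inner_diff_left)
    qed
    then have "(\<integral>y. \<Phi> (merge {1..i} {i+1..n} (x, y)) \<partial>\<kappa> x) = g x * ((\<integral>y. y (i+1) \<bullet> b \<partial>\<kappa> x) - x i \<bullet> b)"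
      using int by (simp add: \<kappa>x.prob_space)
    also have "(\<integral>y. y (i+1) \<bullet> b \<partial>\<kappa> x) = (\<integral>y. y (i+1) \<partial>\<kappa> x) \<bullet> b"
      using int by simp
    finally show ?thesis by (simp add: inner_diff_left)
  qed
  have "(\<integral>x. \<Phi> x \<partial>\<pi>) = (\<integral>x. (\<integral>y. \<Phi> (merge {1..i} {i+1..n} (x, y)) \<partial>\<kappa> x) \<partial>marginal {1..i} X \<pi>)"
    by (rule disintegration_integral[OF \<pi> i dis \<Phi>_meas[unfolded P_def] \<Phi>_bd])
  also have "\<dots> = (\<integral>x. g x * (((\<integral>y. y (i+1) \<partial>\<kappa> x) - x i) \<bullet> b) \<partial>marginal {1..i} X \<pi>)"
    by (intro Bochner_Integration.integral_cong refl inner) (simp only: spm)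
  finally show ?thesis by (simp add: \<Phi>_def)
qed

text \<open>Hedgeable functions integrate to zero against every martingale coupling.\<close>

definition hedgeable :: "((nat \<Rightarrow> 'a) \<Rightarrow> real) \<Rightarrow> bool" where
  "hedgeable G \<longleftrightarrow> (\<exists>\<phi> h. (\<forall>i\<in>{1..n}. continuous_on (X i) (\<phi> i)) \<and>
     (\<forall>i\<in>{1..<n}. \<exists>B. \<forall>x\<in>(\<Pi>\<^sub>E j\<in>{1..i}. X j). norm (h i x :: 'a) \<le> B) \<and>
     (\<Sum>i=1..n. \<integral>z. \<phi> i z \<partial>\<mu> i) = 0 \<and>
     (\<forall>x\<in>K. G x = (\<Sum>i=1..n. \<phi> i (x i)) + (\<Sum>i\<in>{1..<n}. h i (restrict x {1..i}) \<bullet> (x (i+1) - x i))))"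

lemma hedgeableE:
  assumes "hedgeable G"
  obtains \<phi> h where "\<forall>i\<in>{1..n}. continuous_on (X i) (\<phi> i)"
     "\<forall>i\<in>{1..<n}. \<exists>B. \<forall>x\<in>(\<Pi>\<^sub>E j\<in>{1..i}. X j). norm (h i x :: 'a) \<le> B"
     "(\<Sum>i=1..n. \<integral>z. \<phi> i z \<partial>\<mu> i) = 0"
     "\<forall>x\<in>K. G x = (\<Sum>i=1..n. \<phi> i (x i)) + (\<Sum>i\<in>{1..<n}. h i (restrict x {1..i}) \<bullet> (x (i+1) - x i))"
  using assms unfolding hedgeable_def by (elim exE conjE) (rule that)

lemma hedgeable_zero: "hedgeable (\<lambda>_. 0)"
  unfolding hedgeable_def by (intro exI[of _ "\<lambda>_ _. 0"] conjI) (auto intro!: exI[of _ 0])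

lemma hedgeable_add:
  assumes "hedgeable G" "hedgeable G'"
  shows "hedgeable (\<lambda>x. G x + G' x)"
proof -
  obtain \<phi> h where 1: "\<forall>i\<in>{1..n}. continuous_on (X i) (\<phi> i)"
     "\<forall>i\<in>{1..<n}. \<exists>B. \<forall>x\<in>(\<Pi>\<^sub>E j\<in>{1..i}. X j). norm (h i x :: 'a) \<le> B"
     "(\<Sum>i=1..n. \<integral>z. \<phi> i z \<partial>\<mu> i) = 0"
     "\<forall>x\<in>K. G x = (\<Sum>i=1..n. \<phi> i (x i)) + (\<Sum>i\<in>{1..<n}. h i (restrict x {1..i}) \<bullet> (x (i+1) - x i))"
    by (rule hedgeableE[OF assms(1)])
  obtain \<phi>' h' where 2: "\<forall>i\<in>{1..n}. continuous_on (X i) (\<phi>' i)"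
     "\<forall>i\<in>{1..<n}. \<exists>B. \<forall>x\<in>(\<Pi>\<^sub>E j\<in>{1..i}. X j). norm (h' i x :: 'a) \<le> B"
     "(\<Sum>i=1..n. \<integral>z. \<phi>' i z \<partial>\<mu> i) = 0"
     "\<forall>x\<in>K. G' x = (\<Sum>i=1..n. \<phi>' i (x i)) + (\<Sum>i\<in>{1..<n}. h' i (restrict x {1..i}) \<bullet> (x (i+1) - x i))"
    by (rule hedgeableE[OF assms(2)])
  note 1 = 1[rule_format] and 2 = 2[rule_format]
  show ?thesis unfolding hedgeable_def
  proof (rule exI, rule exI, intro conjI ballI)
    show "continuous_on (X i) (\<lambda>z. \<phi> i z + \<phi>' i z)" if "i \<in> {1..n}" for i
      by (intro continuous_on_add 1 2 that)
    show "\<exists>B. \<forall>x\<in>(\<Pi>\<^sub>E j\<in>{1..i}. X j). norm (h i x + h' i x) \<le> B" if i: "i \<in> {1..<n}" for i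
    proof -
      obtain B B' where "\<forall>x\<in>(\<Pi>\<^sub>E j\<in>{1..i}. X j). norm (h i x) \<le> B" "\<forall>x\<in>(\<Pi>\<^sub>E j\<in>{1..i}. X j). norm (h' i x) \<le> B'"
        using 1(2)[OF i] 2(2)[OF i] by (elim exE) (rule that)
      then show ?thesis by (intro exI[of _ "B + B'"] ballI norm_triangle_le add_mono) auto
    qed
    have "(\<integral>z. \<phi> i z + \<phi>' i z \<partial>\<mu> i) = (\<integral>z. \<phi> i z \<partial>\<mu> i) + (\<integral>z. \<phi>' i z \<partial>\<mu> i)" if "i \<in> {1..n}" for i
      by (intro Bochner_Integration.integral_add integrable_borel_probs[OF \<mu>_probs compact_X] 1 2 that)
    then show "(\<Sum>i=1..n. \<integral>z. \<phi> i z + \<phi>' i z \<partial>\<mu> i) = 0"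
      using 1(3) 2(3) by (simp add: sum.distrib)
    fix x assume "x \<in> K"
    then show "G x + G' x = (\<Sum>i=1..n. \<phi> i (x i) + \<phi>' i (x i)) +
        (\<Sum>i\<in>{1..<n}. (h i (restrict x {1..i}) + h' i (restrict x {1..i})) \<bullet> (x (i+1) - x i))"
      by (simp only: 1(4) 2(4) sum.distrib inner_add_left)
  qed
qed

lemma hedgeable_scale:
  assumes "hedgeable G"
  shows "hedgeable (\<lambda>x. a * G x)"
proof -
  obtain \<phi> h where 1: "\<forall>i\<in>{1..n}. continuous_on (X i) (\<phi> i)"
     "\<forall>i\<in>{1..<n}. \<exists>B. \<forall>x\<in>(\<Pi>\<^sub>E j\<in>{1..i}. X j). norm (h i x :: 'a) \<le> B"
     "(\<Sum>i=1..n. \<integral>z. \<phi> i z \<partial>\<mu> i) = 0"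
     "\<forall>x\<in>K. G x = (\<Sum>i=1..n. \<phi> i (x i)) + (\<Sum>i\<in>{1..<n}. h i (restrict x {1..i}) \<bullet> (x (i+1) - x i))"
    by (rule hedgeableE[OF assms])
  note 1 = 1[rule_format]
  show ?thesis unfolding hedgeable_def
  proof (rule exI, rule exI, intro conjI ballI)
    show "continuous_on (X i) (\<lambda>z. a * \<phi> i z)" if "i \<in> {1..n}" for i
      by (intro continuous_intros 1 that)
    show "\<exists>B. \<forall>x\<in>(\<Pi>\<^sub>E j\<in>{1..i}. X j). norm (a *\<^sub>R h i x) \<le> B" if i: "i \<in> {1..<n}" for i
    proof -
      obtain B where "\<forall>x\<in>(\<Pi>\<^sub>E j\<in>{1..i}. X j). norm (h i x) \<le> B" using 1(2)[OF i] by blast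
      then show ?thesis by (intro exI[of _ "\<bar>a\<bar> * B"]) (auto intro!: mult_left_mono)
    qed
    show "(\<Sum>i=1..n. \<integral>z. a * \<phi> i z \<partial>\<mu> i) = 0"
      using 1(3) by (simp add: sum_distrib_left[symmetric])
    fix x assume "x \<in> K"
    then show "a * G x = (\<Sum>i=1..n. a * \<phi> i (x i)) +
        (\<Sum>i\<in>{1..<n}. (a *\<^sub>R h i (restrict x {1..i})) \<bullet> (x (i+1) - x i))"
      by (simp only: 1(4) distrib_left sum_distrib_left inner_scaleR_left)
  qed
qed

lemma hedgeable_sum:
  assumes "\<And>j. j < (m::nat) \<Longrightarrow> hedgeable (G j)"
  shows "hedgeable (\<lambda>x. \<Sum>j<m. a j * G j x)"
  using assms
proof (induction m)
  case 0
  then show ?case using hedgeable_zero by simp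
next
  case (Suc m)
  have "hedgeable (\<lambda>x. (\<Sum>j<m. a j * G j x) + a m * G m x)"
    by (intro hedgeable_add hedgeable_scale Suc) auto
  then show ?case by simp
qed

text \<open>The potentials have total integral 0, so \<open>martingale_dual_bound\<close> yields the
  claim. Together with \<open>hedgeable_sum\<close> it provides the hypothesis \<open>dual\<close>
  of the moment problem; financially, a hedge of zero cost cannot guarantee a profit.\<close>

lemma hedgeable_lower_bound:
  assumes "\<And>i. i \<in> {1..<n} \<Longrightarrow> convex_order (\<mu> i) (\<mu> (i+1))"
    and "hedgeable G" and "\<And>x. x \<in> K \<Longrightarrow> s \<le> G x"
  shows "s \<le> 0"
proof -
  obtain \<phi> h where 1: "\<forall>i\<in>{1..n}. continuous_on (X i) (\<phi> i)"
     "\<forall>i\<in>{1..<n}. \<exists>B. \<forall>x\<in>(\<Pi>\<^sub>E j\<in>{1..i}. X j). norm (h i x :: 'a) \<le> B"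
     "(\<Sum>i=1..n. \<integral>z. \<phi> i z \<partial>\<mu> i) = 0"
     "\<forall>x\<in>K. G x = (\<Sum>i=1..n. \<phi> i (x i)) + (\<Sum>i\<in>{1..<n}. h i (restrict x {1..i}) \<bullet> (x (i+1) - x i))"
    by (rule hedgeableE[OF assms(2)])
  note 1 = 1[rule_format]
  have "s \<le> (\<Sum>i=1..n. \<integral>z. \<phi> i z \<partial>\<mu> i)"
    by (rule martingale_dual_bound[OF n_pos compact_X \<mu>_probs assms(1) 1(1,2)])
      (use assms(3) 1(4) in \<open>auto simp del: One_nat_def\<close>)
  then show ?thesis using 1(3) by simp
qed

text \<open>Centring makes a vanishing integral say that \<open>bump U k\<close> has the same
  integral under the marginal at \<open>i\<close> and under \<open>\<mu> i\<close>.\<close>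

definition marginal_test :: "'a set \<Rightarrow> nat \<Rightarrow> nat \<Rightarrow> (nat \<Rightarrow> 'a) \<Rightarrow> real" where
  "marginal_test U k i x = bump U k (x i) - (\<integral>z. bump U k z \<partial>\<mu> i)"

text \<open>The gain over one period of a strategy in direction \<open>b\<close> that is decided
  from the past alone; its mean vanishes when the increment is orthogonal to that function of the
  past.\<close>

definition increment_test :: "(nat \<Rightarrow> 'a) set \<Rightarrow> nat \<Rightarrow> nat \<Rightarrow> 'a \<Rightarrow> (nat \<Rightarrow> 'a) \<Rightarrow> real" where
  "increment_test U k i b x = bump U k (restrict x {1..i}) * ((x (i+1) - x i) \<bullet> b)"

lemma continuous_marginal_test: "continuous_on K (marginal_test U k i)"
  unfolding marginal_test_def
  by (intro continuous_intros continuous_on_compose2[OF bump_continuous[of UNIV]]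
      continuous_on_subset[OF continuous_on_product_coordinates]) auto

lemma continuous_increment_test: "continuous_on K (increment_test U k i b)"
proof -
  \<comment> \<open>Truncation is continuous for the product topology since the discarded
    coordinates become the constant \<open>undefined\<close>.\<close>
  have "continuous_on UNIV (\<lambda>x::nat \<Rightarrow> 'a. restrict x {1..i})"
  proof (rule continuous_on_coordinatewise_then_product)
    fix j
    show "continuous_on UNIV (\<lambda>x::nat \<Rightarrow> 'a. restrict x {1..i} j)"
    proof (cases "j \<in> {1..i}")
      case False
      then have "(\<lambda>x::nat \<Rightarrow> 'a. restrict x {1..i} j) = (\<lambda>_. undefined)" by (simp only: restrict_apply if_False)
      then show ?thesis by (simp only: continuous_on_const)
    qed (simp del: One_nat_def)
  qed
  then have r: "continuous_on K (\<lambda>x::nat \<Rightarrow> 'a. restrict x {1..i})" by (rule continuous_on_subset) simp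
  have c: "continuous_on K (\<lambda>x::nat \<Rightarrow> 'a. x j)" for j
    by (rule continuous_on_subset[OF continuous_on_product_coordinates]) simp
  show ?thesis unfolding increment_test_def
    by (intro continuous_intros continuous_on_compose2[OF bump_continuous[of UNIV] r] c) auto
qed

lemma hedgeable_marginal_test:
  assumes i: "i \<in> {1..n}"
  shows "hedgeable (marginal_test U k i)"
  unfolding hedgeable_def
proof (rule exI, rule exI, intro conjI ballI)
  let ?c = "\<integral>z. bump U k z \<partial>\<mu> i"
  let ?\<phi> = "\<lambda>j z. if j = i then bump U k z - ?c else 0"
  interpret prob_space "\<mu> i" using \<mu>_probs[OF i] by (simp add: borel_probs_iff)
  show "continuous_on (X j) (?\<phi> j)" for j
    by (cases "j = i") (auto intro!: continuous_intros bump_continuous)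
  show "\<exists>B. \<forall>x\<in>(\<Pi>\<^sub>E j\<in>{1..j}. X j). norm (0::'a) \<le> B" for j by (intro exI[of _ 0]) simp
  have "(\<integral>z. bump U k z - ?c \<partial>\<mu> i) = 0"
    using integrable_borel_probs[OF \<mu>_probs[OF i] compact_X[OF i] bump_continuous[of _ U k]]
    by (simp add: prob_space)
  then have "(\<integral>z. ?\<phi> j z \<partial>\<mu> j) = 0" for j by (cases "j = i") simp_all
  then show "(\<Sum>j=1..n. \<integral>z. ?\<phi> j z \<partial>\<mu> j) = 0" by simp
  fix x
  have "(\<Sum>j=1..n. ?\<phi> j (x j)) = marginal_test U k i x"
    using i by (subst sum.delta) (auto simp: marginal_test_def)
  then show "marginal_test U k i x = (\<Sum>j=1..n. ?\<phi> j (x j)) + (\<Sum>j\<in>{1..<n}. 0 \<bullet> (x (j+1) - x j))"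
    by simp
qed

lemma hedgeable_increment_test:
  assumes i: "i \<in> {1..<n}"
  shows "hedgeable (increment_test U k i b)"
  unfolding hedgeable_def
proof (rule exI, rule exI, intro conjI ballI)
  let ?h = "\<lambda>j x. if j = i then bump U k x *\<^sub>R b else 0"
  show "continuous_on (X j) (\<lambda>z. 0 :: real)" for j by simp
  show "\<exists>B. \<forall>x\<in>(\<Pi>\<^sub>E j\<in>{1..j}. X j). norm (?h j x) \<le> B" for j
    by (intro exI[of _ "norm b"]) (auto simp: bump_bounds abs_of_nonneg intro: mult_left_le_one_le)
  show "(\<Sum>j=1..n. \<integral>z. 0 \<partial>\<mu> j) = 0" by simp
  fix x
  have "(\<Sum>j\<in>{1..<n}. ?h j (restrict x {1..j}) \<bullet> (x (j+1) - x j)) =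
      (\<Sum>j\<in>{1..<n}. if j = i then increment_test U k i b x else 0)"
    by (intro sum.cong) (auto simp: increment_test_def inner_commute)
  also have "\<dots> = increment_test U k i b x" using i by (subst sum.delta) auto
  finally show "increment_test U k i b x = (\<Sum>j=1..n. 0) + (\<Sum>j\<in>{1..<n}. ?h j (restrict x {1..j}) \<bullet> (x (j+1) - x j))"
    by simp
qed

lemma marginal_iff_tests:
  assumes \<pi>: "\<pi> \<in> borel_probs K" and i: "i \<in> {1..n}"
    and B: "Int_stable \<B>" "UNIV \<in> \<B>" "\<And>U. U \<in> \<B> \<Longrightarrow> open U" "sets borel = sigma_sets UNIV \<B>"
  shows "distr \<pi> (restrict_space borel (X i)) (\<lambda>x. x i) = \<mu> i \<longleftrightarrow>
    (\<forall>U\<in>\<B>. \<forall>k. (\<integral>x. marginal_test U k i x \<partial>\<pi>) = 0)"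
proof -
  interpret prob_space \<pi> using \<pi> by (simp add: borel_probs_iff)
  let ?D = "distr \<pi> (restrict_space borel (X i)) (\<lambda>x. x i)"
  have m: "(\<lambda>x. x i) \<in> measurable \<pi> (restrict_space borel (X i))"
  proof -
    have "(\<lambda>x. x i) \<in> measurable (prod_space {1..n} X) (restrict_space borel (X i))"
      unfolding prod_space_def using i by (rule measurable_component_singleton)
    then show ?thesis using sets_probs[OF \<pi>] by (simp cong: measurable_cong_sets)
  qed
  have D: "?D \<in> borel_probs (X i)" using prob_space_distr[OF m] by (simp add: borel_probs_iff)
  have bm: "bump U k \<in> borel_measurable (restrict_space borel (X i))" for U k
    by (rule measurable_restrict_space1[OF bump_measurable])
  have eq: "(\<integral>x. marginal_test U k i x \<partial>\<pi>) = (\<integral>z. bump U k z \<partial>?D) - (\<integral>z. bump U k z \<partial>\<mu> i)" for U k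
  proof -
    have "integrable \<pi> (\<lambda>x. bump U k (x i))"
      using measurable_compose[OF m bm]
      by (intro integrable_const_bound[where B = 1]) (auto simp: bump_bounds)
    then show ?thesis unfolding marginal_test_def
      by (simp add: prob_space integral_distr[OF m bm])
  qed
  show ?thesis
  proof
    assume "?D = \<mu> i"
    then show "\<forall>U\<in>\<B>. \<forall>k. (\<integral>x. marginal_test U k i x \<partial>\<pi>) = 0" by (simp add: eq)
  next
    assume "\<forall>U\<in>\<B>. \<forall>k. (\<integral>x. marginal_test U k i x \<partial>\<pi>) = 0"
    then show "?D = \<mu> i" by (intro borel_probs_eqI[OF D \<mu>_probs[OF i] B]) (auto simp: eq)
  qed
qed

text \<open>By \<open>increment_integral\<close> the tests say that each component of the
  conditional mean increment has zero integral against every \<open>bump U k\<close>, hence vanishes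
  almost everywhere; a finite \<open>Basis\<close> gives finitely many null sets. From right to left
  any version of the kernel will do.\<close>

lemma martingale_iff_tests:
  assumes \<pi>: "\<pi> \<in> borel_probs K" and i: "i \<in> {1..<n}"
    and B: "Int_stable \<B>" "UNIV \<in> \<B>" "\<And>U. U \<in> \<B> \<Longrightarrow> open U" "sets borel = sigma_sets UNIV \<B>"
  shows "(\<exists>\<kappa>. is_disintegration n i X \<pi> \<kappa> \<and>
        (AE x in marginal {1..i} X \<pi>. (\<integral>y. y (i+1) \<partial>\<kappa> x) = x i)) \<longleftrightarrow>
    (\<forall>U\<in>\<B>. \<forall>k. \<forall>b\<in>Basis. (\<integral>x. increment_test U k i b x \<partial>\<pi>) = 0)" (is "?L \<longleftrightarrow> ?R")
proof -
  define N L where "N = prod_space {1..i} X" and "L = prod_space {i+1..n} X"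
  define m where "m = marginal {1..i} X \<pi>"
  have sub: "{1..i} \<subseteq> {1..n}" using i by auto
  interpret m: prob_space m unfolding m_def by (rule prob_space_marginal[OF \<pi> sub])
  have setsm: "sets m = sets N" unfolding m_def N_def by (rule prob_space_marginal[OF \<pi> sub])
  have setsN: "sets N = sets (restrict_space borel (\<Pi>\<^sub>E j\<in>{1..i}. X j))"
    unfolding N_def by (rule sets_prod_space_eq_borel)
  have spm: "space m = (\<Pi>\<^sub>E j\<in>{1..i}. X j)"
    using sets_eq_imp_space_eq[OF setsm] by (simp only: N_def space_prod_space)
  have bm: "bump U k \<in> borel_measurable N" for U k
    using measurable_restrict_space1[OF bump_measurable]
    by (simp only: measurable_cong_sets[OF setsN refl])
  define D where "D \<kappa> b x = ((\<integral>y. y (i+1) \<partial>\<kappa> x) - x i) \<bullet> b" for \<kappa> :: "(nat \<Rightarrow> 'a) \<Rightarrow> (nat \<Rightarrow> 'a) measure" and b x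
  have eq: "(\<integral>x. increment_test U k i b x \<partial>\<pi>) = (\<integral>x. bump U k x * D \<kappa> b x \<partial>m)"
    if "is_disintegration n i X \<pi> \<kappa>" for \<kappa> U k b
    unfolding increment_test_def D_def m_def
    by (rule increment_integral[OF \<pi> i that bm[unfolded N_def]]) (simp add: bump_bounds)
  show ?thesis
  proof
    assume ?L
    then obtain \<kappa> where \<kappa>: "is_disintegration n i X \<pi> \<kappa>" "AE x in m. (\<integral>y. y (i+1) \<partial>\<kappa> x) = x i"
      unfolding m_def by (elim exE conjE)
    show ?R
    proof (intro ballI allI)
      fix U k b
      have "AE x in m. bump U k x * D \<kappa> b x = 0" using \<kappa>(2) by eventually_elim (simp add: D_def)
      then show "(\<integral>x. increment_test U k i b x \<partial>\<pi>) = 0"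
        unfolding eq[OF \<kappa>(1)] by (rule integral_eq_zero_AE)
    qed
  next
    assume R: ?R
    obtain \<kappa> where dis: "is_disintegration n i X \<pi> \<kappa>" by (rule disintegration_exists[OF \<pi> i])
    then have \<kappa>: "\<kappa> \<in> measurable N (prob_algebra L)" by (simp add: is_disintegration_def N_def L_def)
    obtain C where C: "C \<ge> 0" "\<And>j z. j \<in> {1..n} \<Longrightarrow> z \<in> X j \<Longrightarrow> norm z \<le> C" using bounded_X by blast
    have mean_meas: "(\<lambda>x. \<integral>y. y (i+1) \<partial>\<kappa> x) \<in> borel_measurable N"
    proof -
      have *: "(\<lambda>y. y (i+1)) \<in> borel_measurable L" unfolding L_def by (rule coordinate_measurable) (use i in auto)
      show ?thesis
        by (rule measurable_compose[OF measurable_prob_algebraD[OF \<kappa>] integral_measurable_subprob_algebra[OF *]])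
    qed
    have mean_bd: "norm (\<integral>y. y (i+1) \<partial>\<kappa> x) \<le> C" if x: "x \<in> space m" for x
    proof -
      have "x \<in> space N" using x sets_eq_imp_space_eq[OF setsm] by simp
      then have \<kappa>x: "sets (\<kappa> x) = sets L" "prob_space (\<kappa> x)"
        using measurable_space[OF \<kappa>] by (auto simp: space_prob_algebra)
      interpret \<kappa>x: prob_space "\<kappa> x" by fact
      have "norm (\<integral>y. y (i+1) \<partial>\<kappa> x) \<le> (\<integral>y. norm (y (i+1)) \<partial>\<kappa> x)" by (rule integral_norm_bound)
      also have "\<dots> \<le> (\<integral>y. C \<partial>\<kappa> x)"
      proof (rule integral_mono')
        fix y assume "y \<in> space (\<kappa> x)"
        then have "y (i+1) \<in> X (i+1)"
          using sets_eq_imp_space_eq[OF \<kappa>x(1)] i by (auto simp: L_def space_prod_space PiE_iff)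
        then show "norm (y (i+1)) \<le> C" using i by (intro C(2)[of "i+1"]) auto
      qed (use C(1) in auto)
      finally show ?thesis by (simp add: \<kappa>x.prob_space)
    qed
    have "AE x in m. D \<kappa> b x = 0" if b: "b \<in> Basis" for b
    proof (rule AE_zero_if_bump_integrals_zero[OF m.finite_measure_axioms setsm[unfolded setsN] _ B])
      show "(\<integral>x. bump U k x * D \<kappa> b x \<partial>m) = 0" if "U \<in> \<B>" for U k
        using R that b eq[OF dis] by simp
      show "integrable m (D \<kappa> b)"
      proof (rule m.integrable_const_bound[where B = "2 * C"])
        have "(\<lambda>x. x i) \<in> borel_measurable N" unfolding N_def by (rule coordinate_measurable) (use i in auto)
        then show "D \<kappa> b \<in> borel_measurable m"
          using mean_meas setsm unfolding D_def by (simp cong: measurable_cong_sets)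
        show "AE x in m. norm (D \<kappa> b x) \<le> 2 * C"
        proof (rule AE_I2)
          fix x assume x: "x \<in> space m"
          then have "x i \<in> X i" using i by (auto simp: spm PiE_iff)
          then have "norm (x i) \<le> C" using i by (intro C(2)[of i]) auto
          moreover have "norm (D \<kappa> b x) \<le> norm ((\<integral>y. y (i+1) \<partial>\<kappa> x) - x i)"
            unfolding D_def using Basis_le_norm[OF b] by simp
          ultimately show "norm (D \<kappa> b x) \<le> 2 * C"
            using mean_bd[OF x] norm_triangle_ineq4[of "\<integral>y. y (i+1) \<partial>\<kappa> x" "x i"] by linarith
        qed
      qed
    qed
    then have "AE x in m. \<forall>b\<in>Basis. D \<kappa> b x = 0" by (intro AE_finite_allI finite_Basis)
    then have "AE x in m. (\<integral>y. y (i+1) \<partial>\<kappa> x) = x i"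
    proof eventually_elim
      case (elim x)
      show ?case
      proof (rule euclidean_eqI)
        fix b :: 'a assume "b \<in> Basis"
        then have "D \<kappa> b x = 0" using elim by blast
        then show "(\<integral>y. y (i+1) \<partial>\<kappa> x) \<bullet> b = x i \<bullet> b" unfolding D_def inner_diff_left by linarith
      qed
    qed
    then show ?L using dis unfolding m_def by (intro exI[of _ \<kappa>] conjI)
  qed
qed

section \<open>Existence and compactness of martingale couplings\<close>

text \<open>Each property of the family has its own use: continuity makes the constraints survive
  weak limits, hedgeability gives the bound behind existence, and a countable nonempty family can be
  enumerated as a sequence of moments.\<close>

lemma martingale_couplings_as_moments:
  obtains \<G> :: "((nat \<Rightarrow> 'a) \<Rightarrow> real) set" where "countable \<G>" "\<G> \<noteq> {}"
    "\<And>G. G \<in> \<G> \<Longrightarrow> continuous_on K G" "\<And>G. G \<in> \<G> \<Longrightarrow> hedgeable G"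
    "martingale_couplings n X \<mu> = {\<pi> \<in> borel_probs K. \<forall>G\<in>\<G>. (\<integral>x. G x \<partial>\<pi>) = 0}"
proof -
  obtain \<A> :: "'a set set" where A: "countable \<A>" "Int_stable \<A>" "UNIV \<in> \<A>" "\<And>U. U \<in> \<A> \<Longrightarrow> open U"
    "sets borel = sigma_sets UNIV \<A>" by (rule countable_Int_stable_basis) blast
  obtain \<B> :: "(nat \<Rightarrow> 'a) set set" where B: "countable \<B>" "Int_stable \<B>" "UNIV \<in> \<B>" "\<And>U. U \<in> \<B> \<Longrightarrow> open U"
    "sets borel = sigma_sets UNIV \<B>" by (rule countable_Int_stable_basis) blast
  define \<G>1 where "\<G>1 = (\<lambda>(U, k, i). marginal_test U k i) ` (\<A> \<times> UNIV \<times> {1..n})"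
  define \<G>2 where "\<G>2 = (\<lambda>(U, k, i, b). increment_test U k i b) ` (\<B> \<times> UNIV \<times> {1..<n} \<times> Basis)"
  show thesis
  proof
    show "countable (\<G>1 \<union> \<G>2)"
      unfolding \<G>1_def \<G>2_def using A(1) B(1)
      by (intro countable_Un countable_image countable_SIGMA) (auto intro: countable_finite)
    show "\<G>1 \<union> \<G>2 \<noteq> {}" using A(3) n_pos by (auto simp: \<G>1_def)
    show "continuous_on K G" if "G \<in> \<G>1 \<union> \<G>2" for G
      using that continuous_marginal_test continuous_increment_test by (auto simp: \<G>1_def \<G>2_def simp del: One_nat_def)
    show "hedgeable G" if "G \<in> \<G>1 \<union> \<G>2" for G
      using that hedgeable_marginal_test hedgeable_increment_test by (auto simp: \<G>1_def \<G>2_def simp del: One_nat_def)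
    have 1: "(\<forall>i\<in>{1..n}. distr \<pi> (restrict_space borel (X i)) (\<lambda>x. x i) = \<mu> i) \<longleftrightarrow> (\<forall>G\<in>\<G>1. (\<integral>x. G x \<partial>\<pi>) = 0)"
      if \<pi>: "\<pi> \<in> borel_probs K" for \<pi>
    proof -
      have "(\<forall>i\<in>{1..n}. distr \<pi> (restrict_space borel (X i)) (\<lambda>x. x i) = \<mu> i) \<longleftrightarrow>
          (\<forall>i\<in>{1..n}. \<forall>U\<in>\<A>. \<forall>k. (\<integral>x. marginal_test U k i x \<partial>\<pi>) = 0)"
        by (intro ball_cong refl marginal_iff_tests[OF \<pi> _ A(2-5)])
      then show ?thesis unfolding \<G>1_def by (auto simp del: One_nat_def)
    qed
    have 2: "(\<forall>i\<in>{1..<n}. \<exists>\<kappa>. is_disintegration n i X \<pi> \<kappa> \<and>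
        (AE x in marginal {1..i} X \<pi>. (\<integral>y. y (i+1) \<partial>\<kappa> x) = x i)) \<longleftrightarrow> (\<forall>G\<in>\<G>2. (\<integral>x. G x \<partial>\<pi>) = 0)"
      if \<pi>: "\<pi> \<in> borel_probs K" for \<pi>
    proof -
      have "(\<forall>i\<in>{1..<n}. \<exists>\<kappa>. is_disintegration n i X \<pi> \<kappa> \<and>
          (AE x in marginal {1..i} X \<pi>. (\<integral>y. y (i+1) \<partial>\<kappa> x) = x i)) \<longleftrightarrow>
          (\<forall>i\<in>{1..<n}. \<forall>U\<in>\<B>. \<forall>k. \<forall>b\<in>Basis. (\<integral>x. increment_test U k i b x \<partial>\<pi>) = 0)"
        by (intro ball_cong refl martingale_iff_tests[OF \<pi> _ B(2-5)])
      then show ?thesis unfolding \<G>2_def by (auto simp del: One_nat_def)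
    qed
    show "martingale_couplings n X \<mu> = {\<pi> \<in> borel_probs K. \<forall>G\<in>\<G>1 \<union> \<G>2. (\<integral>x. G x \<partial>\<pi>) = 0}"
      unfolding martingale_couplings_def couplings_def using 1 2 by blast
  qed
qed

lemma martingale_couplings_subset: "martingale_couplings n X \<mu> \<subseteq> borel_probs K"
  by (auto simp: martingale_couplings_def couplings_def)

lemma martingale_couplings_nonempty:
  assumes "\<And>i. i \<in> {1..<n} \<Longrightarrow> convex_order (\<mu> i) (\<mu> (i+1))"
  shows "martingale_couplings n X \<mu> \<noteq> {}"
proof -
  obtain \<G> where G: "countable \<G>" "\<G> \<noteq> {}"
    "\<And>G. G \<in> \<G> \<Longrightarrow> continuous_on K G" "\<And>G. G \<in> \<G> \<Longrightarrow> hedgeable G"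
    and eq: "martingale_couplings n X \<mu> = {\<pi> \<in> borel_probs K. \<forall>G\<in>\<G>. (\<integral>x. G x \<partial>\<pi>) = 0}"
    by (rule martingale_couplings_as_moments) blast
  define g where "g = from_nat_into \<G>"
  have g: "g j \<in> \<G>" for j unfolding g_def by (rule from_nat_into[OF G(2)])
  have cont: "continuous_on K (g j)" for j by (rule G(3)[OF g])
  have dual: "s \<le> 0" if "\<And>x. x \<in> K \<Longrightarrow> s \<le> (\<Sum>j<m. a j * g j x)" for m :: nat and a s
    by (rule hedgeable_lower_bound[OF assms hedgeable_sum[OF G(4)[OF g]] that])
  obtain \<gamma> where \<gamma>: "\<gamma> \<in> borel_probs K" "\<And>j. (\<integral>x. g j x \<partial>\<gamma>) = 0"
  proof (rule countable_moments_zero[of K g, OF compact_K K_nonempty cont])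
    show "s \<le> 0" if "\<And>x. x \<in> K \<Longrightarrow> s \<le> (\<Sum>j<m. a j * g j x)" for m :: nat and a s
      by (rule dual[OF that])
  qed (rule that)
  have "(\<integral>x. G x \<partial>\<gamma>) = 0" if "G \<in> \<G>" for G
    using \<gamma>(2) from_nat_into_surj[OF G(1) that] unfolding g_def by metis
  then show ?thesis using \<gamma>(1) eq by blast
qed

text \<open>Compactness is claimed for the planar image only, which avoids putting a topology on
  measures: a sequence of pairs is lifted to couplings, a weakly convergent subsequence is taken,
  and its limit satisfies every moment equation.\<close>

lemma martingale_couplings_compact:
  assumes c: "continuous_on K c" and p: "continuous_on K p"
  shows "compact ((\<lambda>\<pi>. (\<integral>x. c x \<partial>\<pi> :: real, \<integral>x. p x \<partial>\<pi> :: real)) ` martingale_couplings n X \<mu>)"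
proof -
  obtain \<G> where "countable \<G>" "\<G> \<noteq> {}" and G: "\<And>G. G \<in> \<G> \<Longrightarrow> continuous_on K G"
    and "\<And>G. G \<in> \<G> \<Longrightarrow> hedgeable G"
    and eq: "martingale_couplings n X \<mu> = {\<pi> \<in> borel_probs K. \<forall>G\<in>\<G>. (\<integral>x. G x \<partial>\<pi>) = 0}"
    by (rule martingale_couplings_as_moments) blast
  let ?f = "\<lambda>\<pi>. (\<integral>x. c x \<partial>\<pi> :: real, \<integral>x. p x \<partial>\<pi> :: real)"
  let ?M = "martingale_couplings n X \<mu>"
  show ?thesis unfolding compact_eq_seq_compact_metric
  proof (rule seq_compactI)
    fix u :: "nat \<Rightarrow> real \<times> real" assume u: "\<forall>k. u k \<in> ?f ` ?M"
    define \<pi> where "\<pi> k = inv_into ?M ?f (u k)" for k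
    have \<pi>: "\<pi> k \<in> ?M" "u k = ?f (\<pi> k)" for k
      unfolding \<pi>_def using inv_into_into[OF u[rule_format]] f_inv_into_f[OF u[rule_format], symmetric] .
    have \<pi>b: "\<pi> k \<in> borel_probs K" for k using martingale_couplings_subset \<pi>(1) by (rule subsetD)
    obtain r \<rho> where r: "strict_mono r" and \<rho>: "\<rho> \<in> borel_probs K"
      and conv: "\<And>\<phi> :: (nat \<Rightarrow> 'a) \<Rightarrow> real. continuous_on K \<phi> \<Longrightarrow> (\<lambda>k. \<integral>x. \<phi> x \<partial>\<pi> (r k)) \<longlonglongrightarrow> (\<integral>x. \<phi> x \<partial>\<rho>)"
      by (rule borel_probs_seq_compact[of K \<pi>, OF compact_K \<pi>b]) blast
    have "(\<integral>x. G x \<partial>\<rho>) = 0" if "G \<in> \<G>" for G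
    proof -
      have "(\<integral>x. G x \<partial>\<pi> k) = 0" for k
        using \<pi>(1)[of k] that unfolding eq by simp
      then show ?thesis using conv[OF G[OF that]] by (simp add: LIMSEQ_const_iff)
    qed
    then have "\<rho> \<in> ?M" unfolding eq using \<rho> by simp
    moreover have "(u \<circ> r) \<longlonglongrightarrow> ?f \<rho>"
      unfolding comp_def \<pi>(2) by (intro tendsto_Pair conv c p)
    ultimately show "\<exists>l\<in>?f ` ?M. \<exists>r. strict_mono r \<and> (u \<circ> r) \<longlonglongrightarrow> l"
      using r by (intro bexI[of _ "?f \<rho>"] exI[of _ r] conjI imageI)
  qed
qed

end

section \<open>One-sided derivatives of the value function\<close>

text \<open>An envelope formula of Danskin type. Every minimiser of \<open>a\<close> competes for
  all \<open>\<epsilon>\<close>, which bounds the right difference quotient above by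
  \<open>L\<close>. Below, compactness keeps pairs with second coordinate at most
  \<open>L - e\<close> away from the minimal first coordinate, so for small positive
  \<open>\<epsilon>\<close> they cannot win.\<close>

lemma right_derivative_of_infimum:
  fixes a b :: "'s \<Rightarrow> real"
  assumes D: "compact ((\<lambda>s. (a s, b s)) ` S)" and ne: "S \<noteq> {}"
    and T: "T = {s\<in>S. \<forall>t\<in>S. a s \<le> a t}"
  shows "((\<lambda>\<epsilon>. INF s\<in>S. a s + \<epsilon> * b s) has_real_derivative (INF s\<in>T. b s)) (at_right 0)"
proof -
  let ?D = "(\<lambda>s. (a s, b s)) ` S"
  obtain B where B: "B > 0" "\<And>s. s \<in> S \<Longrightarrow> \<bar>b s\<bar> \<le> B" "\<And>s. s \<in> S \<Longrightarrow> \<bar>a s\<bar> \<le> B"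
  proof -
    obtain B where B: "\<forall>x\<in>?D. norm x \<le> B" using compact_imp_bounded[OF D] unfolding bounded_iff by blast
    have "\<bar>b s\<bar> \<le> \<bar>B\<bar> + 1 \<and> \<bar>a s\<bar> \<le> \<bar>B\<bar> + 1" if "s \<in> S" for s
    proof -
      have "norm (a s, b s) \<le> B" using B that by blast
      then show ?thesis using norm_fst_le[of "a s" "b s"] norm_snd_le[of "b s" "a s"] by simp
    qed
    then show thesis by (intro that[of "\<bar>B\<bar> + 1"]) auto
  qed
  have bdd: "bdd_below ((\<lambda>s. a s + \<epsilon> * b s) ` S)" for \<epsilon>
  proof (rule bdd_belowI2[where m = "- B - \<bar>\<epsilon>\<bar> * B"])
    fix s assume "s \<in> S"
    then have "\<bar>\<epsilon> * b s\<bar> \<le> \<bar>\<epsilon>\<bar> * B" using B(2) by (simp add: abs_mult mult_left_mono)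
    then show "- B - \<bar>\<epsilon>\<bar> * B \<le> a s + \<epsilon> * b s" using B(3)[OF \<open>s \<in> S\<close>] by linarith
  qed
  define V where "V \<epsilon> = (INF s\<in>S. a s + \<epsilon> * b s)" for \<epsilon>
  have V_le: "V \<epsilon> \<le> a s + \<epsilon> * b s" if "s \<in> S" for s \<epsilon>
    unfolding V_def by (rule cINF_lower[OF bdd that])
  have V_ge: "v \<le> V \<epsilon>" if "\<And>s. s \<in> S \<Longrightarrow> v \<le> a s + \<epsilon> * b s" for v \<epsilon>
    unfolding V_def by (rule cINF_greatest[OF ne that])
  obtain s0 where s0: "s0 \<in> S" "\<And>s. s \<in> S \<Longrightarrow> a s0 \<le> a s"
    using continuous_attains_inf[OF D, of fst] ne continuous_on_fst[OF continuous_on_id] by auto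
  have V0: "V 0 = a s0"
    by (rule antisym) (use V_le[OF s0(1), of 0] V_ge[of "a s0" 0] s0 in auto)
  have T_eq: "T = {s\<in>S. a s = a s0}" using s0 by (auto simp: T intro: antisym)
  have T_ne: "T \<noteq> {}" using s0 T_eq by auto
  have bddT: "bdd_below (b ` T)"
    by (rule bdd_belowI2[where m = "- B"]) (use B(2) T_eq in force)
  define L where "L = (INF s\<in>T. b s)"
  have upper: "V h \<le> V 0 + h * L" if "h > 0" for h
  proof -
    have "(V h - V 0) / h \<le> b s" if "s \<in> T" for s
      using V_le[of s h] that \<open>h > 0\<close> T_eq V0 by (simp add: field_simps)
    then have "(V h - V 0) / h \<le> L" unfolding L_def by (rule cINF_greatest[OF T_ne])
    then show ?thesis using \<open>h > 0\<close> by (simp add: field_simps)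
  qed
  have lower: "\<exists>d>0. \<forall>h>0. h < d \<longrightarrow> V 0 + h * (L - e) \<le> V h" if "e > 0" for e
  proof -
    let ?E = "?D \<inter> {x. snd x \<le> L - e}"
    have E: "compact ?E"
      by (intro compact_Int_closed D closed_Collect_le continuous_intros)
    have E_gt: "fst x > V 0" if x: "x \<in> ?E" for x
    proof -
      obtain s where s: "s \<in> S" "x = (a s, b s)" "b s \<le> L - e" using x by auto
      have "s \<notin> T" using s(3) cINF_lower[OF bddT, of s] \<open>e > 0\<close> by (auto simp: L_def)
      then show ?thesis using s s0(2)[of s] by (simp add: T_eq V0)
    qed
    \<comment> \<open>An empty \<open>?E\<close> imposes nothing and any positive
      \<open>\<delta>\<close> serves; otherwise the smallest first coordinate is attained on the
      compact set, so the gap is positive.\<close>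
    obtain \<delta> where \<delta>: "\<delta> > 0" "\<And>x. x \<in> ?E \<Longrightarrow> fst x \<ge> V 0 + \<delta>"
    proof (cases "?E = {}")
      case False
      then obtain x where "x \<in> ?E" "\<And>y. y \<in> ?E \<Longrightarrow> fst x \<le> fst y"
        using continuous_attains_inf[OF E False, of fst] continuous_on_fst[OF continuous_on_id] by blast
      then show ?thesis using that[of "fst x - V 0"] E_gt[of x] by auto
    qed (use that[of 1] in auto)
    \<comment> \<open>\<open>c\<close> bounds \<open>L - e - b s\<close> for every \<open>s\<close>,
      so for \<open>h < \<delta> / c\<close> the advantage in the second coordinate stays below the
      gap \<open>\<delta>\<close> in the first.\<close>
    define c where "c = \<bar>L - e\<bar> + B"
    have c: "c > 0" using B(1) by (simp add: c_def)
    show ?thesis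
    proof (intro exI conjI allI impI)
      show "\<delta> / c > 0" using \<delta>(1) c by simp
      fix h :: real assume h: "h > 0" "h < \<delta> / c"
      show "V 0 + h * (L - e) \<le> V h"
      proof (rule V_ge)
        fix s assume s: "s \<in> S"
        show "V 0 + h * (L - e) \<le> a s + h * b s"
        proof (cases "b s \<le> L - e")
          case True
          have "h * (L - e - b s) \<le> h * c" using h(1) B(2)[OF s] by (intro mult_left_mono) (auto simp: c_def)
          also have "\<dots> \<le> \<delta>" using h c by (simp add: field_simps)
          also have "\<delta> \<le> a s - V 0" using \<delta>(2)[of "(a s, b s)"] s True by auto
          finally show ?thesis by (simp add: algebra_simps)
        next
          case False
          then have "h * (L - e) \<le> h * b s" using h(1) by (intro mult_left_mono) auto
          then show ?thesis using s0(2)[OF s] V0 by simp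
        qed
      qed
    qed
  qed
  have "((\<lambda>h. (V h - V 0) / (h - 0)) \<longlongrightarrow> L) (at_right 0)"
  proof (rule tendstoI)
    fix e :: real assume "e > 0"
    then obtain d where "d > 0" and d: "\<And>h. 0 < h \<Longrightarrow> h < d \<Longrightarrow> V 0 + h * (L - e/2) \<le> V h"
      using lower[of "e/2"] by auto
    show "\<forall>\<^sub>F h in at_right 0. dist ((V h - V 0) / (h - 0)) L < e"
      unfolding eventually_at_right_field
    proof (intro exI conjI allI impI)
      show "d > 0" by fact
      fix h :: real assume h: "0 < h" "h < d"
      have "(V h - V 0) / h \<le> L" using upper[OF h(1)] h(1) by (simp add: field_simps)
      moreover have "L - e/2 \<le> (V h - V 0) / h" using d[OF h] h(1) by (simp add: field_simps)
      ultimately show "dist ((V h - V 0) / (h - 0)) L < e" using \<open>e > 0\<close> by (simp add: dist_real_def abs_if)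
    qed
  qed
  then show ?thesis
    unfolding has_field_derivative_iff by (simp add: V_def[abs_def] L_def)
qed

text \<open>Reflecting \<open>\<epsilon>\<close> to \<open>- \<epsilon>\<close> replaces
  \<open>b\<close> by \<open>- b\<close> and leaves \<open>T\<close>, which depends on
  \<open>a\<close> alone, unchanged; the infimum of \<open>- b\<close> becomes the supremum of
  \<open>b\<close> up to sign.\<close>

lemma left_derivative_of_infimum:
  fixes a b :: "'s \<Rightarrow> real"
  assumes D: "compact ((\<lambda>s. (a s, b s)) ` S)" and ne: "S \<noteq> {}"
    and T: "T = {s\<in>S. \<forall>t\<in>S. a s \<le> a t}"
  shows "((\<lambda>\<epsilon>. INF s\<in>S. a s + \<epsilon> * b s) has_real_derivative (SUP s\<in>T. b s)) (at_left 0)"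
proof -
  define V where "V \<epsilon> = (INF s\<in>S. a s + \<epsilon> * b s)" for \<epsilon>
  have "compact ((\<lambda>(u, v). (u, - v)) ` (\<lambda>s. (a s, b s)) ` S)"
    by (intro compact_continuous_image D) (auto simp: split_beta intro!: continuous_intros)
  then have "compact ((\<lambda>s. (a s, - b s)) ` S)" by (simp add: image_image)
  from right_derivative_of_infimum[OF this ne T]
  have "((\<lambda>h. V (- h)) has_real_derivative (INF s\<in>T. - b s)) (at_right 0)"
    by (simp add: V_def[abs_def])
  \<comment> \<open>On the reals \<open>Inf\<close> is by definition the negated \<open>Sup\<close>
    of the negated set, so this is an unfolding.\<close>
  moreover have "(INF s\<in>T. - b s) = - (SUP s\<in>T. b s)"
    by (simp add: Inf_real_def image_image)
  ultimately have "((\<lambda>h. (V (- h) - V 0) / h) \<longlongrightarrow> - (SUP s\<in>T. b s)) (at_right 0)"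
    unfolding has_field_derivative_iff by simp
  from tendsto_minus[OF this]
  have "((\<lambda>h. (V h - V 0) / (h - 0)) \<longlongrightarrow> (SUP s\<in>T. b s)) (at_left 0)"
    unfolding filterlim_at_left_to_right by simp
  then show ?thesis unfolding has_field_derivative_iff V_def[abs_def] by simp
qed

theorem proposition2p10:
  fixes X :: "nat \<Rightarrow> 'a::euclidean_space set"
    and \<mu> :: "nat \<Rightarrow> 'a measure"
    and c p :: "(nat \<Rightarrow> 'a) \<Rightarrow> real"
    and P :: "real \<Rightarrow> real"
    and n :: nat
  assumes "n \<ge> 1"
    and "\<And>i. i \<in> {1..n} \<Longrightarrow> compact (X i)"
    and "\<And>i. i \<in> {1..n} \<Longrightarrow> \<mu> i \<in> borel_probs (X i)"
    and "\<And>i. i \<in> {1..<n} \<Longrightarrow> convex_order (\<mu> i) (\<mu> (i+1))"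
    and "continuous_on (\<Pi>\<^sub>E i\<in>{1..n}. X i) c"
    and "continuous_on (\<Pi>\<^sub>E i\<in>{1..n}. X i) p"
    and "P = (\<lambda>\<epsilon>. mot_value n X \<mu> (\<lambda>x. c x + \<epsilon> * p x))"
  shows "(P has_real_derivative (INF \<pi>\<in>mot_optimizers n X \<mu> c. \<integral>x. p x \<partial>\<pi>)) (at_right 0) \<and>
    (P has_real_derivative (SUP \<pi>\<in>mot_optimizers n X \<mu> c. \<integral>x. p x \<partial>\<pi>)) (at_left 0) \<and>
    (\<forall>\<pi>\<^sub>0. mot_optimizers n X \<mu> c = {\<pi>\<^sub>0} \<longrightarrow> (P has_real_derivative (\<integral>x. p x \<partial>\<pi>\<^sub>0)) (at 0))"
proof -
  interpret compact_marginals n X \<mu> using assms(1-3) by unfold_locales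
  let ?M = "martingale_couplings n X \<mu>" and ?T = "mot_optimizers n X \<mu> c"
  let ?a = "\<lambda>\<pi>. \<integral>x. c x \<partial>\<pi>" and ?b = "\<lambda>\<pi>. \<integral>x. p x \<partial>\<pi>"
  \<comment> \<open>\<open>c\<close> and \<open>p\<close> are integrable against every coupling by
    compactness, so linearity puts \<open>P\<close> into the form of the envelope formulas.\<close>
  have P: "P = (\<lambda>\<epsilon>. INF \<pi>\<in>?M. ?a \<pi> + \<epsilon> * ?b \<pi>)"
    unfolding assms(7) mot_value_def
  proof (intro ext INF_cong refl)
    fix \<epsilon> \<pi> assume "\<pi> \<in> ?M"
    then have "\<pi> \<in> borel_probs K" using martingale_couplings_subset by blast
    then have "integrable \<pi> c" "integrable \<pi> p"
      by (rule integrable_borel_probs[OF _ compact_K assms(5)], rule integrable_borel_probs[OF _ compact_K assms(6)])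
    then show "(\<integral>x. c x + \<epsilon> * p x \<partial>\<pi>) = ?a \<pi> + \<epsilon> * ?b \<pi>" by simp
  qed
  have D: "compact ((\<lambda>\<pi>. (?a \<pi>, ?b \<pi>)) ` ?M)" by (rule martingale_couplings_compact[OF assms(5,6)])
  have ne: "?M \<noteq> {}" by (rule martingale_couplings_nonempty[OF assms(4)])
  have T: "?T = {\<pi>\<in>?M. \<forall>\<pi>'\<in>?M. ?a \<pi> \<le> ?a \<pi>'}"
    unfolding mot_optimizers_def is_arg_min_def by (auto simp: not_less)
  have right: "(P has_real_derivative (INF \<pi>\<in>?T. ?b \<pi>)) (at_right 0)"
    unfolding P by (rule right_derivative_of_infimum[OF D ne T])
  have left: "(P has_real_derivative (SUP \<pi>\<in>?T. ?b \<pi>)) (at_left 0)"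
    unfolding P by (rule left_derivative_of_infimum[OF D ne T])
  \<comment> \<open>For a single optimiser the infimum and the supremum are both its integral of
    \<open>p\<close>, so the one-sided limits agree and combine into a limit at 0.\<close>
  have "(P has_real_derivative (?b \<pi>\<^sub>0)) (at 0)" if "?T = {\<pi>\<^sub>0}" for \<pi>\<^sub>0
    using left right unfolding that has_field_derivative_iff by (intro filterlim_split_at) simp_all
  then show ?thesis using left right by blast
qed

end
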